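(* Let $\mathcal C$ be a plane curve over $\mathbb C$ defined by an irreducible polynomial $f\in\mathbb R[x,y]$, such that $(0:1:0)$ is not an infinity point of $\mathcal C$. Let $B$ be an infinity branch of $\mathcal C$ associated to the infinity point $(1:m:0)$, $m\in\mathbb C$, given by $$r(z)=mz+a_1z^{1-n_1/n}+\cdots+a_kz^{1-n_k/n}+A(z),$$ where $a_1,\dots,a_k\in\mathbb C\setminus\{0\}$, $n,n_1,\dots,n_k\in\mathbb N$, $0<n_1<\cdots<n_k\le n$, $\gcd(n,n_1,\dots,n_k)=1$, and $A(z)$ collects all terms of $r(z)$ with negative exponent. Let $$\tilde r(z)=mz+a_1z^{1-n_1/n}+\cdots+a_kz^{1-n_k/n},$$ and let $\widetilde{\mathcal C}$ be the (unique) irreducible plane algebraic curve over $\mathbb C$ containing the branch $\{(z,\tilde r(z)):|z|>\widetilde M\}$, i.e. the curve parametrized by $$\widetilde{\mathcal Q}(t)=(t^n,\;mt^n+a_1t^{n-n_1}+\cdots+a_kt^{n-n_k})\in\mathbb C[t]^2 .$$ Then $\widetilde{\mathcal C}$ is an asymptote (generalized asymptote) of $\mathcal C$ at $B$; that is, $\widetilde{\mathcal C}$ is a perfect curve and it approaches $\mathcal C$ at $B$.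
   Context: Curves. A plane curve over $\mathbb C$ is the zero set in $\mathbb C^2$ of an irreducible polynomial $f\in\mathbb C[x,y]$ of degree $d\ge 1$; $d$ is the degree of the curve. Write $f=f_d+f_{d-1}+\cdots+f_0$ with $f_i$ homogeneous of degree $i$, and $F(x,y,z)=f_d+zf_{d-1}+\cdots+z^df_0$ for the polynomial of its projective closure. The infinity points are the points $(a:b:0)$ with $f_d(a,b)=0$. Infinity branches. Let $\mathcal C$ be a curve and $(1:m:0)$, $m\in\mathbb C$, an infinity point. Put $g(y,z)=F(1,y,z)$. Let $\varphi(z)=m+a_1z^{N_1/N}+a_2z^{N_2/N}+\cdots$ (finitely or infinitely many terms, $a_i\ne0$, $N,N_i\in\mathbb N$, $0<N_1<N_2<\cdots$) be a Puiseux series with $g(\varphi(z),z)=0$ and ramification index $N$ (the least common denominator of its exponents). Its conjugates are $\varphi_j(z)=m+a_1c_j^{N_1}z^{N_1/N}+a_2c_j^{N_2}z^{N_2/N}+\cdots$, where $c_1,\dots,c_N$ are the $N$-th roots of unity. Put $r_j(z)=z\varphi_j(z^{-1})=mz+a_1c_j^{N_1}z^{1-N_1/N}+a_2c_j^{N_2}z^{1-N_2/N}+\cdots$, which converges for $|z|>M$ for some $M>0$. The set $B=\bigcup_{j=1}^N L_j$, with leaves $L_j=\{(z,r_j(z))\in\mathbb C^2: |z|>M\}$, is an infinity branch of $\mathcal C$ associated to $(1:m:0)$. It is determined, up to conjugation, by any one series $r=r_j$, and one says that $B$ is given by $r$. Approaching curves. Let $d(p,\overline{\mathcal C})$ be the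 usual distance in $\mathbb C^2$ from a point $p$ to a curve $\overline{\mathcal C}$. A curve $\overline{\mathcal C}$ approaches $\mathcal C$ at its infinity branch $B$ if there is a leaf $\{(z,r(z)):|z|>M\}\subset B$ with $\lim_{z\to\infty}d((z,r(z)),\overline{\mathcal C})=0$. Perfect curves and asymptotes. A curve of degree $d$ (not having $(0:1:0)$ as infinity point) is perfect if it cannot be approached, at any of its infinity branches, by any curve over $\mathbb C$ of degree less than $d$. An asymptote (g-asymptote) of $\mathcal C$ at $B$ is a perfect curve that approaches $\mathcal C$ at $B$. *)

theory Defs
  imports
    "HOL-Analysis.Analysis"
    "HOL-Computational_Algebra.Computational_Algebra"
begin

text \<open>
  A polynomial in two variables is a polynomial in \<open>y\<close> with coefficients in \<open>\<complex>[x]\<close>: the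
  coefficient of \<open>x ^ i * y ^ j\<close> in \<open>f\<close> is \<open>coeff (coeff f j) i\<close>.  A plane curve is carried
  around by an irreducible polynomial defining it (unique up to a nonzero constant); the
  curve as a set of points is \<open>zero_set f\<close>.
\<close>

definition zero_set :: "complex poly poly \<Rightarrow> (complex \<times> complex) set" where
  "zero_set f = {(x, y). poly (poly f [:y:]) x = 0}"

definition total_degree :: "complex poly poly \<Rightarrow> nat" where
  "total_degree f = Max {i + j | i j. coeff (coeff f j) i \<noteq> 0}"

text \<open>
  The homogeneous part \<open>f\<^sub>l\<close> and the homogenization \<open>F\<close> are evaluated in an arbitrary
  commutative ring into which \<open>\<iota>\<close> maps the coefficients, since points need values in \<open>\<complex>\<close>
  and branches need values in a ring of power series.
\<close>

definition homog_part ::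
    "(complex \<Rightarrow> 'a::comm_ring_1) \<Rightarrow> complex poly poly \<Rightarrow> nat \<Rightarrow> 'a \<Rightarrow> 'a \<Rightarrow> 'a" where
  "homog_part \<iota> f l X Y = (\<Sum>j\<le>l. \<iota> (coeff (coeff f j) (l - j)) * X ^ (l - j) * Y ^ j)"

definition homogenization ::
    "(complex \<Rightarrow> 'a::comm_ring_1) \<Rightarrow> complex poly poly \<Rightarrow> 'a \<Rightarrow> 'a \<Rightarrow> 'a \<Rightarrow> 'a" where
  "homogenization \<iota> f X Y Z =
     (\<Sum>l\<le>total_degree f. Z ^ (total_degree f - l) * homog_part \<iota> f l X Y)"

text \<open>The point \<open>(a : b : 0)\<close>, in homogeneous coordinates.\<close>

definition infinity_point :: "complex poly poly \<Rightarrow> complex \<Rightarrow> complex \<Rightarrow> bool" where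
  "infinity_point f a b \<longleftrightarrow>
     (a, b) \<noteq> (0, 0) \<and> homog_part (\<lambda>c. c) f (total_degree f) a b = 0"

text \<open>
  The Puiseux series \<open>\<phi>(z) = \<Sum>i. \<phi>\<^sub>i * z powr (i / N)\<close> is represented by \<open>N\<close> and the power
  series \<open>\<phi>\<close> in \<open>s\<close>, where \<open>s ^ N = z\<close>.  The \<open>LEAST\<close> is the least common denominator of the
  exponents \<open>i / N\<close> that occur.
\<close>

definition ramification_index :: "nat \<Rightarrow> complex fps \<Rightarrow> nat" where
  "ramification_index N \<phi> =
     (LEAST d. 0 < d \<and>
        (\<forall>i. fps_nth \<phi> i \<noteq> 0 \<longrightarrow> of_nat d * (of_nat i / of_nat N) \<in> (\<int> :: rat set)))"

text \<open>
  Roots are principal: \<open>z powr (- 1 / N)\<close> is the principal value, and the other values are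
  reached through the \<open>N\<close>-th roots of unity \<open>c\<close> that give the conjugates.
\<close>

definition branch_series ::
    "complex poly poly \<Rightarrow> complex \<Rightarrow> nat \<Rightarrow> complex fps \<Rightarrow> real \<Rightarrow> bool" where
  "branch_series f m N \<phi> M \<longleftrightarrow>
     infinity_point f 1 m \<and> 0 < N \<and> fps_nth \<phi> 0 = m \<and>
     ramification_index N \<phi> = N \<and>
     homogenization fps_const f 1 \<phi> (fps_X ^ N) = 0 \<and>
     0 < M \<and>
     (\<forall>z. M < norm z \<longrightarrow> summable (\<lambda>i. fps_nth \<phi> i * (z powr (- 1 / of_nat N)) ^ i))"

text \<open>\<open>leaf_fun N \<phi> c\<close> is \<open>z * \<phi>\<^sub>c (1 / z)\<close> for the conjugate \<open>\<phi>\<^sub>c\<close> of \<open>\<phi>\<close> determined by \<open>c\<close>.\<close>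

definition leaf_fun :: "nat \<Rightarrow> complex fps \<Rightarrow> complex \<Rightarrow> complex \<Rightarrow> complex" where
  "leaf_fun N \<phi> c z = z * eval_fps \<phi> (c * z powr (- 1 / of_nat N))"

definition leaf :: "nat \<Rightarrow> complex fps \<Rightarrow> real \<Rightarrow> complex \<Rightarrow> (complex \<times> complex) set" where
  "leaf N \<phi> M c = {(z, leaf_fun N \<phi> c z) | z. M < norm z}"

definition branch :: "nat \<Rightarrow> complex fps \<Rightarrow> real \<Rightarrow> (complex \<times> complex) set" where
  "branch N \<phi> M = (\<Union>c\<in>{c. c ^ N = 1}. leaf N \<phi> M c)"

definition infinity_branch ::
    "complex poly poly \<Rightarrow> complex \<Rightarrow> (complex \<times> complex) set \<Rightarrow> bool" where
  "infinity_branch f m B \<longleftrightarrow> (\<exists>N \<phi> M. branch_series f m N \<phi> M \<and> B = branch N \<phi> M)"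

text \<open>
  The exponents and coefficients of the nonzero terms of \<open>z * \<phi> (1 / z)\<close>, the linear term
  \<open>m * z\<close> excepted.
\<close>

definition branch_terms :: "nat \<Rightarrow> complex fps \<Rightarrow> (rat \<times> complex) set" where
  "branch_terms N \<phi> =
     {(1 - of_nat i / of_nat N, fps_nth \<phi> i) | i. 0 < i \<and> fps_nth \<phi> i \<noteq> 0}"

text \<open>The curve of \<open>g\<close> approaches the curve of \<open>f\<close> at the infinity branch \<open>B\<close> of the latter.\<close>

definition approaches ::
    "complex poly poly \<Rightarrow> complex poly poly \<Rightarrow> (complex \<times> complex) set \<Rightarrow> bool" where
  "approaches g f B \<longleftrightarrow>
     (\<exists>m N \<phi> M c. branch_series f m N \<phi> M \<and> B = branch N \<phi> M \<and> c ^ N = 1 \<and>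
        ((\<lambda>z. infdist (z, leaf_fun N \<phi> c z) (zero_set g)) \<longlongrightarrow> 0) at_infinity)"

definition perfect_curve :: "complex poly poly \<Rightarrow> bool" where
  "perfect_curve f \<longleftrightarrow>
     irreducible f \<and> \<not> infinity_point f 0 1 \<and>
     (\<forall>m B. infinity_branch f m B \<longrightarrow>
        \<not> (\<exists>g. irreducible g \<and> total_degree g < total_degree f \<and> approaches g f B))"

definition asymptote ::
    "complex poly poly \<Rightarrow> complex poly poly \<Rightarrow> (complex \<times> complex) set \<Rightarrow> bool" where
  "asymptote g f B \<longleftrightarrow> perfect_curve g \<and> approaches g f B"

end

theory Submission imports Defs begin

text \<open>
  Write \<open>q t = m t\<^sup>n + a\<^sub>1 t ^ (n - n\<^sub>1) + \<dots>\<close>.  By the gcd condition the \<open>n\<close> conjugates \<open>q (c t)\<close>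
  with \<open>c ^ n = 1\<close> are distinct polynomials, hence stay a positive distance apart for large \<open>t\<close>.
  The norm \<open>\<Prod>\<^sub>c (y - q (c t))\<close> is a polynomial in \<open>x = t\<^sup>n\<close> and \<open>y\<close>, of total degree \<open>n\<close>, that
  divides every polynomial vanishing on the parametrized curve; it is the irreducible equation.

  For perfection, let a curve \<open>g\<close> approach one branch.  Moving the parameter slightly, one gets
  points \<open>(t\<^sup>n, q t + u)\<close> of \<open>g\<close> with \<open>u\<close> small, along some unbounded sequence of \<open>t\<close>.  Whether
  \<open>g (t\<^sup>n, q t + u)\<close> has a small root \<open>u\<close> depends only on the degrees in \<open>t\<close> of its coefficients, so
  such a root exists for all large \<open>t\<close>, in particular for all the \<open>c t\<close> at once.  Thus \<open>g (t\<^sup>n, y)\<close>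
  has \<open>n\<close> distinct roots \<open>y\<close>, and the degree of \<open>g\<close> is at least \<open>n\<close>.
\<close>

subsection \<open>Polynomial growth and small roots\<close>

lemma poly_over_power_tendsto:
  fixes p :: "complex poly"
  assumes "degree p \<le> n"
  shows "((\<lambda>t. poly p t / t ^ n) \<longlongrightarrow> coeff p n) at_infinity"
proof -
  have summand: "((\<lambda>t. coeff p i * (1 / t) ^ (n - i)) \<longlongrightarrow> coeff p i * 0 ^ (n - i)) at_infinity" for i
    by (intro tendsto_intros) (simp add: tendsto_inverse_0 divide_inverse)
  have "((\<lambda>t. \<Sum>i\<le>n. coeff p i * (1 / t) ^ (n - i)) \<longlongrightarrow> (\<Sum>i\<le>n. coeff p i * 0 ^ (n - i))) at_infinity"
    by (intro tendsto_sum summand)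
  also have "(\<Sum>i\<le>n. coeff p i * 0 ^ (n - i)) = (\<Sum>i\<in>{n}. coeff p i)"
    by (rule sum.mono_neutral_cong_right) auto
  also have "\<dots> = coeff p n" by simp
  finally show ?thesis
  proof (rule Lim_transform_eventually)
    have "(\<Sum>i\<le>n. coeff p i * (1 / t) ^ (n - i)) = poly p t / t ^ n" if "t \<noteq> 0" for t
    proof -
      have "poly p t = (\<Sum>i\<le>n. coeff p i * t ^ i)"
        using assms by (subst poly_altdef) (auto intro!: sum.mono_neutral_left le_degree)
      then show ?thesis
        using that by (auto simp: sum_divide_distrib power_one_over power_diff intro!: sum.cong)
    qed
    then show "\<forall>\<^sub>F t in at_infinity. (\<Sum>i\<le>n. coeff p i * (1 / t) ^ (n - i)) = poly p t / t ^ n"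
      by (intro eventually_mono[OF eventually_not_equal_at_infinity[of 0]]) auto
  qed
qed

lemma poly_divide_tendsto:
  fixes p r :: "complex poly"
  assumes "degree p \<le> degree r" and "r \<noteq> 0"
  shows "((\<lambda>t. poly p t / poly r t) \<longlongrightarrow> coeff p (degree r) / lead_coeff r) at_infinity"
proof -
  have "((\<lambda>t. (poly p t / t ^ degree r) / (poly r t / t ^ degree r))
      \<longlongrightarrow> coeff p (degree r) / lead_coeff r) at_infinity"
    using assms by (intro tendsto_divide poly_over_power_tendsto) auto
  then show ?thesis
    by (rule Lim_transform_eventually)
       (intro eventually_mono[OF eventually_not_equal_at_infinity[of 0]], auto)
qed

lemma eventually_poly_nonzero:
  fixes r :: "complex poly"
  assumes "r \<noteq> 0"
  shows "\<forall>\<^sub>F t in at_infinity. poly r t \<noteq> 0"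
proof -
  obtain b where "\<forall>t\<in>{t. poly r t = 0}. norm t \<le> b"
    using finite_imp_bounded[OF poly_roots_finite[OF assms]] by (auto simp: bounded_iff)
  then show ?thesis
    unfolding eventually_at_infinity by (intro exI[of _ "b + 1"]) force
qed

text \<open>The reciprocal of a nonzero polynomial has a finite limit at infinity, so it is
  eventually bounded. Nonzero constants are included, which matters because conjugates may differ by
  a constant.\<close>

lemma eventually_poly_bounded_below:
  fixes r :: "complex poly"
  assumes "r \<noteq> 0"
  shows "\<exists>e>0. \<forall>\<^sub>F t in at_infinity. e \<le> norm (poly r t)"
proof -
  have "((\<lambda>t. poly 1 t / poly r t) \<longlongrightarrow> coeff 1 (degree r) / lead_coeff r) at_infinity"
    using assms by (intro poly_divide_tendsto) auto
  then have "((\<lambda>t. norm (1 / poly r t)) \<longlongrightarrow> norm (coeff 1 (degree r) / lead_coeff r)) at_infinity"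
    by (intro tendsto_norm) simp
  then have "\<forall>\<^sub>F t in at_infinity. norm (1 / poly r t) < norm (coeff 1 (degree r) / lead_coeff r) + 1"
    by (rule order_tendstoD) simp
  with eventually_poly_nonzero[OF assms]
  have "\<forall>\<^sub>F t in at_infinity. 1 / (norm (coeff 1 (degree r) / lead_coeff r) + 1) \<le> norm (poly r t)"
  proof eventually_elim
    case (elim t)
    have "0 < norm (coeff 1 (degree r) / lead_coeff r) + 1"
      by (simp add: add_nonneg_pos)
    with elim show ?case by (simp add: norm_divide field_simps)
  qed
  then show ?thesis
    by (intro exI[of _ "1 / (norm (coeff 1 (degree r) / lead_coeff r) + 1)"]) 
       (simp add: add_nonneg_pos)
qed

text \<open>The weighted coefficient norm at most doubles its ratio to the constant coefficient with
  each linear factor.\<close>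

lemma weighted_coeff_le:
  fixes p :: "complex poly"
  assumes "0 < e" and "\<And>u. poly p u = 0 \<Longrightarrow> e \<le> norm u"
  shows "norm (coeff p i) * e ^ i \<le> 2 ^ degree p * norm (coeff p 0)"
  using assms(2)
proof (induction "degree p" arbitrary: p i)
  case 0
  then show ?case
    by (cases "i = 0") (auto simp: coeff_eq_0)
next
  case (Suc d)
  then have "\<not> constant (poly p)" by (simp add: constant_degree)
  then obtain a where a: "poly p a = 0" using fundamental_theorem_of_algebra by blast
  then obtain r where r: "p = [:- a, 1:] * r" by (metis poly_eq_0_iff_dvd dvdE)
  with Suc.hyps have "r \<noteq> 0" by auto
  then have deg: "d = degree r" using Suc.hyps r by (simp add: degree_mult_eq del: mult_pCons_left)
  have IH: "norm (coeff r i) * e ^ i \<le> 2 ^ d * norm (coeff r 0)" for i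
    using Suc.hyps(1)[of r i] deg Suc.prems r by auto
  have ea: "e \<le> norm a" using Suc.prems a by blast
  have c0: "norm (coeff p 0) = norm a * norm (coeff r 0)"
    by (simp add: r norm_mult)
  show ?case
  proof (cases i)
    case 0
    have "1 * norm (coeff p 0) \<le> 2 ^ degree p * norm (coeff p 0)"
      by (intro mult_right_mono) auto
    then show ?thesis using 0 by simp
  next
    case (Suc j)
    have "norm (coeff p i) * e ^ i = norm (coeff r j - a * coeff r i) * e ^ i"
      using Suc by (simp add: r)
    also have "\<dots> \<le> (norm (coeff r j) + norm a * norm (coeff r i)) * e ^ i"
      using assms(1) norm_triangle_ineq4[of "coeff r j" "a * coeff r i"]
      by (intro mult_right_mono) (auto simp: norm_mult)
    also have "\<dots> = e * (norm (coeff r j) * e ^ j) + norm a * (norm (coeff r i) * e ^ i)"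
      using Suc by (simp add: algebra_simps)
    \<comment> \<open>The factor \<open>e\<close> of the first term is raised to
      \<open>norm a\<close>, using that \<open>a\<close> is itself a root; the two equal halves
      account for the extra factor 2.\<close>
    also have "\<dots> \<le> norm a * (2 ^ d * norm (coeff r 0)) + norm a * (2 ^ d * norm (coeff r 0))"
      using assms(1) ea by (intro add_mono mult_mono[OF ea IH] mult_left_mono[OF IH]) auto
    also have "\<dots> = 2 ^ degree p * norm (coeff p 0)"
      using Suc.hyps(2) c0 by (simp flip: \<open>Suc d = degree p\<close>)
    finally show ?thesis .
  qed
qed

text \<open>Fixing x = t first leaves a polynomial in y alone, to which root counting and
  \<open>weighted_coeff_le\<close> apply.\<close>

lemma poly_poly_eval:
  fixes G :: "'a::comm_ring_1 poly poly"
  shows "poly (map_poly (\<lambda>c. poly c t) G) u = poly (poly G [:u:]) t"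
  by (induction G) (simp_all add: map_poly_pCons)

lemma coeff_map_poly_eval [simp]: "coeff (map_poly (\<lambda>c. poly c t) G) i = poly (coeff G i) t"
  by (simp add: coeff_map_poly)

text \<open>Small roots are governed by the degrees of the coefficients alone, so having them along
  one unbounded sequence forces them everywhere near infinity.\<close>

lemma small_root_frequently_imp_eventually:
  fixes G :: "complex poly poly"
  assumes freq: "\<And>e. 0 < e \<Longrightarrow> \<exists>\<^sub>F t in at_infinity. \<exists>u. norm u < e \<and> poly (poly G [:u:]) t = 0"
    and "0 < e"
  shows "\<forall>\<^sub>F t in at_infinity. \<exists>u. norm u < e \<and> poly (poly G [:u:]) t = 0"
proof (cases "coeff G 0 = 0")
  case True
  then have "poly (poly G [:0:]) t = 0" for t
    by (simp add: poly_0_coeff_0)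
  then show ?thesis using \<open>0 < e\<close> by (intro always_eventually allI exI[of _ 0]) simp
next
  case c0: False
  \<comment> \<open>If some coefficient outgrows the constant one, a disc without roots would
    contradict \<open>weighted_coeff_le\<close>. Otherwise the constant coefficient dominates and
    some fixed disc is eventually free of roots, against \<open>freq\<close>.\<close>
  show ?thesis
  proof (cases "\<exists>i. degree (coeff G 0) < degree (coeff G i)")
    case True
    then obtain i where i: "degree (coeff G 0) < degree (coeff G i)" by blast
    then have ci: "coeff G i \<noteq> 0" by auto
    \<comment> \<open>Chosen so that the estimate below bounds a positive quantity by half of
      itself.\<close>
    define k where "k = e ^ i / (2 * 2 ^ degree G)"
    have k: "0 < k" using \<open>0 < e\<close> by (simp add: k_def)
    have "((\<lambda>t. poly (coeff G 0) t / poly (coeff G i) t) \<longlongrightarrow> 0) at_infinity"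
      using poly_divide_tendsto[of "coeff G 0" "coeff G i"] i ci by (simp add: coeff_eq_0)
    then have "\<forall>\<^sub>F t in at_infinity. norm (poly (coeff G 0) t / poly (coeff G i) t) < k"
      using k by (simp add: tendsto_iff dist_norm)
    with eventually_poly_nonzero[OF ci] show ?thesis
    proof eventually_elim
      case (elim t)
      show ?case
      proof (rule ccontr)
        assume none: "\<not> (\<exists>u. norm u < e \<and> poly (poly G [:u:]) t = 0)"
        define p where "p = map_poly (\<lambda>c. poly c t) G"
        have "norm (coeff p i) * e ^ i \<le> 2 ^ degree p * norm (coeff p 0)"
          using none \<open>0 < e\<close> by (intro weighted_coeff_le) (auto simp: p_def poly_poly_eval not_less)
        also have "\<dots> \<le> 2 ^ degree G * norm (coeff p 0)"
          by (intro mult_right_mono power_increasing) (auto simp: p_def map_poly_degree_leq)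
        also have "\<dots> \<le> 2 ^ degree G * (k * norm (coeff p i))"
          using elim by (intro mult_left_mono) (auto simp: p_def norm_divide field_simps)
        also have "\<dots> = norm (coeff p i) * e ^ i / 2"
          by (simp add: k_def)
        finally show False using elim \<open>0 < e\<close> by (simp add: p_def)
      qed
    qed
  next
    case False
    have "\<exists>K. \<forall>\<^sub>F t in at_infinity. norm (poly (coeff G i) t) \<le> K * norm (poly (coeff G 0) t)" for i
    proof -
      have "((\<lambda>t. norm (poly (coeff G i) t / poly (coeff G 0) t)) \<longlongrightarrow>
          norm (coeff (coeff G i) (degree (coeff G 0)) / lead_coeff (coeff G 0))) at_infinity"
        using False c0 by (intro tendsto_norm poly_divide_tendsto) (auto simp: not_less)
      then have "\<forall>\<^sub>F t in at_infinity. norm (poly (coeff G i) t / poly (coeff G 0) t) <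
          norm (coeff (coeff G i) (degree (coeff G 0)) / lead_coeff (coeff G 0)) + 1"
        by (rule order_tendstoD) simp
      with eventually_poly_nonzero[OF c0]
      have "\<forall>\<^sub>F t in at_infinity. norm (poly (coeff G i) t) \<le>
        (norm (coeff (coeff G i) (degree (coeff G 0)) / lead_coeff (coeff G 0)) + 1) * norm (poly (coeff G 0) t)"
      proof eventually_elim
        case (elim t)
        then show ?case by (simp add: norm_divide divide_less_eq)
      qed
      then show ?thesis by blast
    qed
    then obtain K where K: "\<And>i. \<forall>\<^sub>F t in at_infinity. norm (poly (coeff G i) t) \<le> K i * norm (poly (coeff G 0) t)"
      by metis
    \<comment> \<open>The summand 1 makes norm u < 1 / L imply both norm u <= 1 and (L - 1) * norm u
      < 1, so the remaining terms cannot cancel the constant one.\<close>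
    define L where "L = (\<Sum>i\<le>degree G. \<bar>K i\<bar>) + 1"
    have L: "1 \<le> L" by (simp add: L_def sum_nonneg)
    have "\<forall>\<^sub>F t in at_infinity. \<forall>i\<in>{..degree G}. norm (poly (coeff G i) t) \<le> K i * norm (poly (coeff G 0) t)"
      using K by (intro eventually_ball_finite) auto
    with eventually_poly_nonzero[OF c0]
    have "\<forall>\<^sub>F t in at_infinity. \<not> (\<exists>u. norm u < 1 / L \<and> poly (poly G [:u:]) t = 0)"
    proof eventually_elim
      case (elim t)
      let ?c = "\<lambda>i. poly (coeff G i) t"
      have "?c 0 = 0" if u: "norm u < 1 / L" "poly (poly G [:u:]) t = 0" for u
      proof (rule ccontr)
        assume nz: "?c 0 \<noteq> 0"
        have u1: "norm u \<le> 1"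
          using u(1) L by (smt (verit) divide_le_eq_1)
        have "(\<Sum>i\<le>degree G. ?c i * u ^ i) = 0"
        proof -
          have "poly (poly G [:u:]) t = (\<Sum>i\<le>degree G. ?c i * u ^ i)"
            by (subst poly_altdef) (simp add: poly_sum)
          then show ?thesis using u(2) by simp
        qed
        then have "?c 0 = - (\<Sum>i\<in>{..degree G} - {0}. ?c i * u ^ i)"
          by (simp add: sum.remove[of "{..degree G}" 0] add_eq_0_iff)
        then have "norm (?c 0) \<le> (\<Sum>i\<in>{..degree G} - {0}. norm (?c i * u ^ i))"
          by (simp only: norm_minus_cancel norm_sum)
        also have "\<dots> \<le> (\<Sum>i\<in>{..degree G} - {0}. \<bar>K i\<bar> * norm (?c 0) * norm u)"
        proof (rule sum_mono)
          fix i assume i: "i \<in> {..degree G} - {0}"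
          then have "norm (?c i) \<le> K i * norm (?c 0)" using elim by auto
          also have "\<dots> \<le> \<bar>K i\<bar> * norm (?c 0)" by (intro mult_right_mono) auto
          finally have 1: "norm (?c i) \<le> \<bar>K i\<bar> * norm (?c 0)" .
          have "norm u ^ i \<le> norm u"
            using power_decreasing[of 1 i "norm u"] i u1 by simp
          with 1 show "norm (?c i * u ^ i) \<le> \<bar>K i\<bar> * norm (?c 0) * norm u"
            by (auto simp: norm_mult norm_power intro!: mult_mono)
        qed
        also have "\<dots> \<le> (\<Sum>i\<le>degree G. \<bar>K i\<bar> * norm (?c 0) * norm u)"
          by (intro sum_mono2) auto
        also have "\<dots> = (L - 1) * norm u * norm (?c 0)"
          by (simp add: L_def sum_distrib_right sum_distrib_left mult_ac)
        also have "\<dots> < norm (?c 0)"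
        proof -
          have "L * norm u < 1" using u(1) L by (simp add: field_simps)
          then have "(L - 1) * norm u < 1" by (smt (verit) mult_right_mono norm_ge_zero)
          then show ?thesis using nz by (simp add: mult_less_cancel_right1)
        qed
        finally show False by simp
      qed
      with elim show ?case by blast
    qed
    with freq[of "1 / L"] L show ?thesis
      by (simp add: frequently_def)
  qed
qed

text \<open>Horner's rule, with each coefficient taken at t ^ n and the variable y replaced by q +
  u. The result is a genuine polynomial in t and u, so facts about polynomials apply along the
  parametrized curve.\<close>

lemma substitute_param:
  fixes g :: "complex poly poly" and q :: "complex poly" and n :: nat
  shows "\<exists>G. \<forall>t u. poly (poly G [:u:]) t = poly (poly g [:poly q t + u:]) (t ^ n)"
proof (induction g)
  case 0
  show ?case by (rule exI[of _ 0]) simp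
next
  case (pCons a g)
  then obtain G where "\<And>t u. poly (poly G [:u:]) t = poly (poly g [:poly q t + u:]) (t ^ n)" by blast
  then show ?case
    by (intro exI[of _ "[:pcompose a (monom 1 n):] + [:q, 1:] * G"])
       (simp add: poly_pcompose poly_monom algebra_simps)
qed

subsection \<open>Conjugate parametrizations and the norm polynomial\<close>

text \<open>The order \<open>d\<close> of \<open>e\<close> divides every exponent in
  \<open>A\<close>, hence their gcd; membership of \<open>n\<close> makes the order finite.\<close>

lemma root_of_unity_eq_1:
  fixes e :: complex
  assumes "0 < n" "\<And>i. i \<in> A \<Longrightarrow> e ^ i = 1" "n \<in> A" "Gcd A = (1::nat)"
  shows "e = 1"
proof -
  define d where "d = (LEAST d. 0 < d \<and> e ^ d = 1)"
  have d: "0 < d \<and> e ^ d = 1"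
    unfolding d_def by (rule LeastI[of _ n]) (use assms in auto)
  have least: "d \<le> k" if "0 < k" "e ^ k = 1" for k
    unfolding d_def using that by (intro Least_le) auto
  have "d dvd i" if "i \<in> A" for i
  proof -
    have "e ^ i = (e ^ d) ^ (i div d) * e ^ (i mod d)"
      by (simp flip: power_mult power_add)
    then have "e ^ (i mod d) = 1" using d assms(2)[OF that] by simp
    moreover have "i mod d < d" using d by simp
    ultimately have "i mod d = 0" using least[of "i mod d"] by fastforce
    then show ?thesis by auto
  qed
  then have "d dvd Gcd A" by (intro Gcd_greatest)
  then show ?thesis using assms(4) d by simp
qed

text \<open>Otherwise all n roots of unity would be roots of X ^ (i mod n) - 1, whose degree is
  positive but less than n.\<close>

lemma dvd_if_all_roots_of_unity:
  assumes "0 < n" and all: "\<And>c::complex. c ^ n = 1 \<Longrightarrow> c ^ i = 1"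
  shows "n dvd i"
proof (rule ccontr)
  assume "\<not> n dvd i"
  then have r: "1 \<le> i mod n" by (simp add: Suc_le_eq mod_greater_zero_iff_not_dvd)
  have "c ^ (i mod n) = 1" if "c ^ n = 1" for c :: complex
  proof -
    have "c ^ i = (c ^ n) ^ (i div n) * c ^ (i mod n)"
      by (simp flip: power_mult power_add)
    then show ?thesis using that all by simp
  qed
  then have "card {c::complex. c ^ n = 1} \<le> card {c::complex. c ^ (i mod n) = 1}"
    using r by (intro card_mono finite_roots_unity) auto
  then have "n \<le> card {c::complex. c ^ (i mod n) = 1}"
    using assms(1) by (simp add: card_roots_unity_eq)
  also have "\<dots> \<le> i mod n" using r by (rule card_roots_unity)
  also have "\<dots> < n" using assms(1) by simp
  finally show False by simp
qed

text \<open>Replacing t by c t multiplies the i-th coefficient by c ^ i, so invariance leaves only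
  exponents divisible by \<open>n\<close>.\<close>

lemma invariant_poly_in_power:
  fixes p :: "complex poly"
  assumes "0 < n" and inv: "\<And>c t. c ^ n = 1 \<Longrightarrow> poly p (c * t) = poly p t"
  shows "\<exists>p'. \<forall>t. poly p' (t ^ n) = poly p t"
proof -
  have dvd: "n dvd i" if "coeff p i \<noteq> 0" for i
  proof (rule dvd_if_all_roots_of_unity[OF assms(1)])
    fix c :: complex assume "c ^ n = 1"
    then have "poly (pcompose p [:0, c:]) t = poly p t" for t
      using inv by (simp add: poly_pcompose mult.commute)
    then have "pcompose p [:0, c:] = p" by (intro poly_eq_poly_eq_iff[THEN iffD1] ext)
    then have "c ^ i * coeff p i = coeff p i" by (metis coeff_pcompose_linear)
    then show "c ^ i = 1" using that by simp
  qed
  define p' where "p' = (\<Sum>i\<le>degree p. monom (coeff p i) (i div n))"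
  have "poly p' (t ^ n) = poly p t" for t
  proof -
    have "coeff p i * (t ^ n) ^ (i div n) = coeff p i * t ^ i" for i
      using dvd[of i] by (cases "coeff p i = 0") (auto simp flip: power_mult)
    then show ?thesis
      unfolding p'_def by (simp only: poly_sum poly_monom poly_altdef[of p])
  qed
  then show ?thesis by blast
qed

text \<open>Give y the weight \<open>n\<close> and x the weight 1: each factor then has weight at
  most \<open>n\<close>, and weights add in a product.\<close>

lemma weighted_degree_linear_prod:
  fixes p :: "'a \<Rightarrow> complex poly"
  assumes "finite A" "\<And>c. c \<in> A \<Longrightarrow> degree (p c) \<le> n" "coeff (\<Prod>c\<in>A. [:- p c, 1:]) j \<noteq> 0"
  shows "degree (coeff (\<Prod>c\<in>A. [:- p c, 1:]) j) + n * j \<le> n * card A"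
  using assms
proof (induction A arbitrary: j rule: finite_induct)
  case empty
  then show ?case by (cases j) auto
next
  case (insert c A)
  define P where "P = (\<Prod>c\<in>A. [:- p c, 1:])"
  have IH: "degree (coeff P j) + n * j \<le> n * card A" if "coeff P j \<noteq> 0" for j
    using insert that by (simp add: P_def)
  have eq: "coeff (\<Prod>c\<in>insert c A. [:- p c, 1:]) j =
      (case j of 0 \<Rightarrow> 0 | Suc i \<Rightarrow> coeff P i) - p c * coeff P j"
    using insert.hyps by (simp add: P_def coeff_pCons split: nat.splits)
  have deg: "degree (p c) \<le> n" using insert.prems by simp
  have 1: "degree (p c * coeff P j) + n * j \<le> n * card (insert c A)" if "coeff P j \<noteq> 0"
    using IH[OF that] deg degree_mult_le[of "p c" "coeff P j"] insert.hyps by simp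
  have 2: "degree (coeff P i) + n * Suc i \<le> n * card (insert c A)" if "coeff P i \<noteq> 0" for i
    using IH[OF that] insert.hyps by simp
  show ?case
  proof (cases j)
    case 0
    then have "coeff P j \<noteq> 0" using insert.prems eq by auto
    then show ?thesis using 1 0 unfolding eq by simp
  next
    case (Suc i)
    have *: "degree (coeff P i - p c * coeff P j) \<le>
        max (degree (coeff P i)) (degree (p c * coeff P j))"
      by (rule degree_diff_le_max)
    show ?thesis
    \<comment> \<open>Vanishing coefficients are separated because the zero polynomial has degree 0,
      for which the weighted bound can fail.\<close>
    proof (cases "coeff P i = 0"; cases "coeff P j = 0")
      assume "coeff P i = 0" "coeff P j = 0"
      then show ?thesis using insert.prems(2) eq Suc by simp
    next
      assume "coeff P i = 0" "coeff P j \<noteq> 0"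
      then show ?thesis unfolding eq using 1 Suc by simp
    next
      assume "coeff P i \<noteq> 0" "coeff P j = 0"
      then show ?thesis unfolding eq using 2[of i] Suc by simp
    next
      assume nz: "coeff P i \<noteq> 0" "coeff P j \<noteq> 0"
      show ?thesis unfolding eq using * 1[OF nz(2)] 2[OF nz(1)] unfolding Suc by (simp add: max_def split: if_splits)
    qed
  qed
qed

text \<open>Distinct conjugates mean that the map from t to (t ^ n, q t) is injective apart from
  finitely many t. The degree bound is what keeps (0 : 1 : 0) off the curve.\<close>

locale polynomial_parametrization =
  fixes n :: nat and q :: "complex poly"
  assumes n_pos: "0 < n" and degree_q: "degree q \<le> n"
    and conjugates_distinct: "\<And>c c'. c ^ n = 1 \<Longrightarrow> c' ^ n = 1 \<Longrightarrow>
      pcompose q [:0, c:] = pcompose q [:0, c':] \<Longrightarrow> c = c'"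
begin

abbreviation roots :: "complex set" where "roots \<equiv> {c. c ^ n = 1}"

lemma finite_roots: "finite roots"
  using n_pos by (intro finite_roots_unity) simp

lemma card_roots: "card roots = n"
  using n_pos by (rule card_roots_unity_eq)

text \<open>Each of the finitely many differences is a nonzero polynomial in t, so it is eventually
  bounded away from 0, and the least of these bounds serves all pairs.\<close>

lemma conjugates_separated:
  "\<exists>e>0. \<forall>\<^sub>F t in at_infinity. \<forall>c\<in>roots. \<forall>c'\<in>roots. c \<noteq> c' \<longrightarrow>
     e \<le> norm (poly q (c * t) - poly q (c' * t))"
proof -
  define D where "D = {(c, c'). c \<in> roots \<and> c' \<in> roots \<and> c \<noteq> c'}"
  have fin: "finite D"
    by (rule finite_subset[of _ "roots \<times> roots"]) (auto simp: D_def finite_roots)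
  have "\<exists>e>0. \<forall>\<^sub>F t in at_infinity. e \<le> norm (poly q (fst d * t) - poly q (snd d * t))" if "d \<in> D" for d
  proof -
    have "pcompose q [:0, fst d:] - pcompose q [:0, snd d:] \<noteq> 0"
      using conjugates_distinct[of "fst d" "snd d"] that by (auto simp: D_def)
    from eventually_poly_bounded_below[OF this] show ?thesis
      by (simp add: poly_pcompose mult.commute)
  qed
  then obtain e where e: "\<And>d. d \<in> D \<Longrightarrow> 0 < e d"
    "\<And>d. d \<in> D \<Longrightarrow> \<forall>\<^sub>F t in at_infinity. e d \<le> norm (poly q (fst d * t) - poly q (snd d * t))"
    by metis
  \<comment> \<open>Inserting 1 keeps the set nonempty when n = 1 and there are no pairs.\<close>
  define e0 where "e0 = Min (insert 1 (e ` D))"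
  have "0 < e0" using fin e by (auto simp: e0_def)
  have e0: "e0 \<le> e d" if "d \<in> D" for d using fin that by (auto simp: e0_def)
  have "\<forall>\<^sub>F t in at_infinity. \<forall>d\<in>D. e d \<le> norm (poly q (fst d * t) - poly q (snd d * t))"
    using e fin by (intro eventually_ball_finite) auto
  then have "\<forall>\<^sub>F t in at_infinity. \<forall>c\<in>roots. \<forall>c'\<in>roots. c \<noteq> c' \<longrightarrow>
     e0 \<le> norm (poly q (c * t) - poly q (c' * t))"
  proof eventually_elim
    case (elim t)
    show ?case
    proof (intro ballI impI)
      fix c c' assume "c \<in> roots" "c' \<in> roots" "c \<noteq> c'"
      then have "(c, c') \<in> D" by (simp add: D_def)
      with elim e0 show "e0 \<le> norm (poly q (c * t) - poly q (c' * t))" by fastforce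
    qed
  qed
  with \<open>0 < e0\<close> show ?thesis by blast
qed

text \<open>Roots of unity have norm 1, so complements of discs around 0 are invariant under
  multiplication by them.\<close>

lemma eventually_conjugate:
  assumes "\<forall>\<^sub>F t in at_infinity. P (t::complex)"
  shows "\<forall>\<^sub>F t in at_infinity. \<forall>c\<in>roots. P (c * t)"
proof -
  obtain b where b: "\<And>t. b \<le> norm t \<Longrightarrow> P t"
    using assms by (auto simp: eventually_at_infinity)
  have "norm c = 1" if "c \<in> roots" for c
  proof -
    have "norm c ^ n = 1" using that by (simp flip: norm_power)
    then show ?thesis using n_pos power_eq_imp_eq_base[of "norm c" n 1] by simp
  qed
  with b show ?thesis
    unfolding eventually_at_infinity by (intro exI[of _ b]) (auto simp: norm_mult)
qed

text \<open>For large \<open>t\<close> the \<open>n\<close> conjugates \<open>q (c t)\<close> are uniformly separated, so nearby roots of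
  \<open>R (t ^ n, \<cdot>)\<close> are distinct and too many for its degree.\<close>

lemma eq_0_if_roots_near_conjugates:
  fixes R :: "complex poly poly"
  assumes deg: "degree R < n"
    and near: "\<And>e. 0 < e \<Longrightarrow>
      \<forall>\<^sub>F t in at_infinity. \<exists>u. norm u < e \<and> poly (poly R [:poly q t + u:]) (t ^ n) = 0"
  shows "R = 0"
proof (rule ccontr)
  assume "R \<noteq> 0"
  obtain e where "0 < e" and e: "\<forall>\<^sub>F t in at_infinity. \<forall>c\<in>roots. \<forall>c'\<in>roots. c \<noteq> c' \<longrightarrow>
     e \<le> norm (poly q (c * t) - poly q (c' * t))"
    using conjugates_separated by blast
  \<comment> \<open>Half the separation, so that two displaced conjugates cannot coincide.\<close>
  have "\<forall>\<^sub>F t in at_infinity. \<exists>u. norm u < e / 2 \<and> poly (poly R [:poly q t + u:]) (t ^ n) = 0"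
    using \<open>0 < e\<close> by (intro near) simp
  note 1 = eventually_conjugate[OF this]
  \<comment> \<open>This keeps \<open>R\<close> nonzero after specialising x = t ^ n, so that its
    degree bounds the number of its roots.\<close>
  have "pcompose (lead_coeff R) (monom 1 n) \<noteq> 0"
    using \<open>R \<noteq> 0\<close> n_pos by (simp add: pcompose_eq_0_iff degree_monom_eq)
  note 2 = eventually_poly_nonzero[OF this]
  from 1 2 e have "\<forall>\<^sub>F t::complex in at_infinity. False"
  proof eventually_elim
    case (elim t)
    define p where "p = map_poly (\<lambda>a. poly a (t ^ n)) R"
    have "coeff p (degree R) \<noteq> 0"
      using elim(2) by (simp add: p_def poly_pcompose poly_monom)
    then have "p \<noteq> 0" by auto
    obtain u where u: "\<And>c. c \<in> roots \<Longrightarrow> norm (u c) < e / 2"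
      "\<And>c. c \<in> roots \<Longrightarrow> poly (poly R [:poly q (c * t) + u c:]) ((c * t) ^ n) = 0"
      using elim(1) by metis
    define y where "y c = poly q (c * t) + u c" for c
    have "poly p (y c) = 0" if "c \<in> roots" for c
      using u(2)[OF that] that by (simp add: p_def poly_poly_eval y_def power_mult_distrib)
    moreover have "inj_on y roots"
    proof (rule inj_onI, rule ccontr)
      fix c c' assume c: "c \<in> roots" "c' \<in> roots" "y c = y c'" "c \<noteq> c'"
      then have "e \<le> norm (poly q (c * t) - poly q (c' * t))" using elim(3) by blast
      also have "poly q (c * t) - poly q (c' * t) = u c' - u c"
        using c(3) by (simp add: y_def algebra_simps)
      also have "norm \<dots> \<le> norm (u c') + norm (u c)" by (rule norm_triangle_ineq4)
      also have "\<dots> < e" using u(1)[OF c(1)] u(1)[OF c(2)] by simp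
      finally show False by simp
    qed
    ultimately have "card roots \<le> card {x. poly p x = 0}"
      using poly_roots_finite[OF \<open>p \<noteq> 0\<close>] by (intro card_inj_on_le[of y]) auto
    also have "\<dots> \<le> degree p" using \<open>p \<noteq> 0\<close> by (rule card_poly_roots_bound)
    also have "\<dots> \<le> degree R" by (simp add: p_def map_poly_degree_leq)
    finally show False using deg by (simp add: card_roots)
  qed
  then show False by (simp add: trivial_limit_at_infinity)
qed

text \<open>The product of the y - q (c t) over all conjugates is invariant under t -> c t, so its
  coefficients are polynomials in t ^ n; writing x for t ^ n gives \<open>H\<close>.\<close>

lemma norm_polynomial_exists:
  "\<exists>H :: complex poly poly. degree H = n \<and> coeff H n = 1 \<and>
     (\<forall>j i. coeff (coeff H j) i \<noteq> 0 \<longrightarrow> i + j \<le> n) \<and>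
     (\<forall>t y. poly (poly H [:y:]) (t ^ n) = (\<Prod>c\<in>roots. y - poly q (c * t)))"
proof -
  define P :: "complex poly poly" where "P = (\<Prod>c\<in>roots. [:- pcompose q [:0, c:], 1:])"
  have degP: "degree P = n"
    unfolding P_def by (subst degree_prod_sum_eq) (simp_all add: card_roots)
  have evalP: "poly (poly P [:y:]) t = (\<Prod>c\<in>roots. y - poly q (c * t))" for y t
    by (simp add: P_def poly_prod poly_pcompose mult.commute)
  have inv: "poly (coeff P j) (c * t) = poly (coeff P j) t" if "c ^ n = 1" for c t j
  proof -
    have "c \<noteq> 0" using that n_pos by (auto simp: power_0_left)
    \<comment> \<open>Replacing t by c t merely permutes the factors of the product.\<close>
    have "bij_betw (\<lambda>d. d * c) roots roots"
      by (rule bij_betwI[of _ _ _ "\<lambda>d. d / c"])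
         (use that \<open>c \<noteq> 0\<close> in \<open>auto simp: power_mult_distrib power_divide\<close>)
    then have "poly (poly P [:y:]) (c * t) = poly (poly P [:y:]) t" for y
      unfolding evalP
      by (subst prod.reindex_bij_betw[symmetric, of "\<lambda>d. d * c" roots roots]) (simp_all add: mult_ac)
    then have "poly (map_poly (\<lambda>a. poly a (c * t)) P) = poly (map_poly (\<lambda>a. poly a t) P)"
      by (simp add: poly_poly_eval fun_eq_iff)
    then show ?thesis
      by (metis coeff_map_poly_eval poly_eq_poly_eq_iff)
  qed
  have "\<exists>p'. \<forall>t. poly p' (t ^ n) = poly (coeff P j) t" for j
    by (rule invariant_poly_in_power[OF n_pos]) (rule inv)
  then obtain h where h: "\<And>j t. poly (h j) (t ^ n) = poly (coeff P j) t"
    by metis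
  define H where "H = (\<Sum>j\<le>n. monom (h j) j)"
  have h_eq: "pcompose (h j) (monom 1 n) = coeff P j" for j
    using h by (intro poly_eq_poly_eq_iff[THEN iffD1] ext) (simp add: poly_pcompose poly_monom)
  have coeffH: "coeff H j = h j" for j
  proof (cases "j \<le> n")
    case False
    then have "pcompose (h j) (monom 1 n) = 0" using h_eq degP by (simp add: coeff_eq_0)
    then have "h j = 0" using n_pos by (simp add: pcompose_eq_0_iff degree_monom_eq)
    then show ?thesis using False by (simp add: H_def coeff_sum)
  qed (simp add: H_def coeff_sum)
  have lcP: "coeff P n = 1"
  proof -
    have "lead_coeff P = 1" unfolding P_def by (subst lead_coeff_prod) simp
    then show ?thesis by (simp add: degP)
  qed
  have "pcompose (h n - 1) (monom 1 n) = 0"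
    by (simp add: pcompose_diff h_eq lcP pcompose_1)
  then have hn: "h n = 1" using n_pos by (simp add: pcompose_eq_0_iff degree_monom_eq)
  have "degree H = n"
    by (intro antisym le_degree degree_le) (auto simp: coeffH hn H_def coeff_sum)
  moreover have "i + j \<le> n" if "coeff (coeff H j) i \<noteq> 0" for i j
  proof -
    have "h j \<noteq> 0" using that coeffH by auto
    then have nz: "coeff P j \<noteq> 0"
      using n_pos by (simp flip: h_eq add: pcompose_eq_0_iff degree_monom_eq)
    have "degree (pcompose q [:0, c:]) \<le> n" for c
      using degree_pcompose_le[of q "[:0, c:]"] degree_q by (auto split: if_splits)
    then have "degree (coeff P j) + n * j \<le> n * n"
      using weighted_degree_linear_prod[OF finite_roots, of "\<lambda>c. pcompose q [:0, c:]" n j] nz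
      by (simp add: P_def card_roots)
    \<comment> \<open>Degrees in t are n times degrees in x, so dividing the weighted bound by
      \<open>n\<close> bounds the ordinary total degree.\<close>
    also have "degree (coeff P j) = degree (h j) * n"
      by (simp flip: h_eq add: degree_pcompose degree_monom_eq)
    finally have "n * (degree (h j) + j) \<le> n * n" by (simp add: algebra_simps)
    then have "degree (h j) + j \<le> n" using n_pos by simp
    moreover have "i \<le> degree (h j)" using that by (intro le_degree) (simp add: coeffH)
    ultimately show ?thesis by simp
  qed
  moreover have "poly (poly H [:y:]) (t ^ n) = (\<Prod>c\<in>roots. y - poly q (c * t))" for y t
  proof -
    have "map_poly (\<lambda>a. poly a (t ^ n)) H = map_poly (\<lambda>a. poly a t) P"
      by (intro poly_eqI) (simp add: coeffH h)
    then show ?thesis by (metis evalP poly_poly_eval)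
  qed
  moreover have "coeff H n = 1" by (simp add: coeffH hn)
  ultimately show ?thesis by (intro exI[of _ H] conjI allI impI) simp_all
qed

end

subsection \<open>The irreducible equation of the parametrized curve\<close>

text \<open>The remainder modulo \<open>H\<close> has y-degree below \<open>n\<close> and vanishes
  on the curve, so it is killed by \<open>eq_0_if_roots_near_conjugates\<close> with displacement u
  = 0.\<close>

lemma (in polynomial_parametrization) norm_polynomial_dvd:
  fixes H A :: "complex poly poly"
  assumes H: "degree H = n" "coeff H n = 1"
    "\<And>t y. poly (poly H [:y:]) (t ^ n) = (\<Prod>c\<in>roots. y - poly q (c * t))"
    and A: "\<And>t. (t ^ n, poly q t) \<in> zero_set A"
  shows "H dvd A"
proof -
  \<comment> \<open>\<open>H\<close> is monic in y, so pseudo-division is honest division.\<close>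
  obtain B R where BR: "pseudo_divmod A H = (B, R)" by fastforce
  have "H \<noteq> 0" using H by auto
  from pseudo_divmod[OF this BR] have AR: "A = H * B + R" and R: "R = 0 \<or> degree R < n"
    using H by simp_all
  have "R = 0"
  proof (rule ccontr)
    assume "R \<noteq> 0"
    have "poly (poly R [:poly q t:]) (t ^ n) = 0" for t
    proof -
      have "poly (poly H [:poly q t:]) (t ^ n) = 0"
        unfolding H(3) by (intro prod_zero finite_roots bexI[of _ 1]) auto
      then show ?thesis using A[of t] by (simp add: AR zero_set_def)
    qed
    then have "\<exists>u. norm u < e \<and> poly (poly R [:poly q t + u:]) (t ^ n) = 0" if "0 < e" for e t
      using that by (intro exI[of _ 0]) simp
    then have "R = 0"
      using R \<open>R \<noteq> 0\<close> by (intro eq_0_if_roots_near_conjugates always_eventually allI) auto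
    with \<open>R \<noteq> 0\<close> show False by simp
  qed
  then show ?thesis using AR by simp
qed

section \<open>Total degree, points at infinity and nonempty zero sets\<close>

lemma total_degree_infinity_point:
  fixes h :: "complex poly poly"
  assumes bound: "\<And>i j. coeff (coeff h j) i \<noteq> 0 \<Longrightarrow> i + j \<le> n" and "coeff (coeff h n) 0 \<noteq> 0"
  shows "total_degree h = n \<and> \<not> infinity_point h 0 1"
proof -
  have "{i + j |i j. coeff (coeff h j) i \<noteq> 0} \<subseteq> {..n}" using bound by auto
  moreover have "n \<in> {i + j |i j. coeff (coeff h j) i \<noteq> 0}"
    using assms(2) by (intro CollectI exI[of _ 0] exI[of _ n]) simp
  ultimately have deg: "total_degree h = n"
    unfolding total_degree_def
    by (intro Max_eqI) (auto intro: finite_subset[OF _ finite_atMost])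
  \<comment> \<open>At (0 : 1 : 0) every monomial of degree n except y ^ n vanishes.\<close>
  have "homog_part (\<lambda>c. c) h n 0 1 = (\<Sum>j\<in>{n}. coeff (coeff h j) (n - j))"
    unfolding homog_part_def by (rule sum.mono_neutral_cong_right) auto
  then show ?thesis using deg assms(2) by (simp add: infinity_point_def)
qed

text \<open>What has to be shown is that finitely many degrees occur, so that \<open>Max\<close> is
  a true maximum.\<close>

lemma le_total_degree:
  fixes f :: "complex poly poly"
  assumes "coeff (coeff f j) i \<noteq> 0"
  shows "i + j \<le> total_degree f"
proof -
  have "{i + j |i j. coeff (coeff f j) i \<noteq> 0} \<subseteq>
      (\<Union>j\<le>degree f. (\<lambda>i. i + j) ` {..degree (coeff f j)})"
  proof safe
    fix i j assume "coeff (coeff f j) i \<noteq> 0"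
    then have "i \<le> degree (coeff f j)" "j \<le> degree f" by (auto intro: le_degree)
    then show "i + j \<in> (\<Union>j\<le>degree f. (\<lambda>i. i + j) ` {..degree (coeff f j)})" by blast
  qed
  then have "finite {i + j |i j. coeff (coeff f j) i \<noteq> 0}"
    by (rule finite_subset) auto
  then show ?thesis unfolding total_degree_def by (rule Max_ge) (use assms in blast)
qed

lemma degree_le_total_degree: "degree f \<le> total_degree f"
proof (cases "f = 0")
  case False
  then have "coeff (coeff f (degree f)) (degree (lead_coeff f)) \<noteq> 0" by simp
  from le_total_degree[OF this] show ?thesis by simp
qed simp

text \<open>Needed because \<open>infdist x {} = 0\<close>, so an empty curve would approach everything.\<close>

lemma zero_set_nonempty:
  fixes g :: "complex poly poly"
  assumes "irreducible g"
  shows "zero_set g \<noteq> {}"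
proof -
  have nz: "g \<noteq> 0" and nu: "\<not> g dvd 1" using assms by (auto simp: irreducible_def)
  show ?thesis
  proof (cases "degree g = 0")
    case True
    then obtain p where p: "g = [:p:]" by (elim degree_eq_zeroE)
    have "\<not> constant (poly p)"
      using nu nz by (simp add: p constant_degree is_unit_const_poly_iff is_unit_iff_degree)
    then obtain x where "poly p x = 0" using fundamental_theorem_of_algebra by blast
    then have "(x, 0) \<in> zero_set g" by (simp add: zero_set_def p)
    then show ?thesis by blast
  next
    case False
    \<comment> \<open>On a vertical line where the leading coefficient does not vanish, the degree
      in y survives and a root exists.\<close>
    obtain x where x: "poly (lead_coeff g) x \<noteq> 0"
      using eventually_happens[OF eventually_poly_nonzero[of "lead_coeff g"]] nz
      by (auto simp: trivial_limit_at_infinity)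
    define p where "p = map_poly (\<lambda>c. poly c x) g"
    have "degree g \<le> degree p" using x by (intro le_degree) (simp add: p_def)
    then have "\<not> constant (poly p)" using False by (simp add: constant_degree)
    then obtain y where "poly p y = 0" using fundamental_theorem_of_algebra by blast
    then have "(x, y) \<in> zero_set g" by (simp add: zero_set_def p_def poly_poly_eval)
    then show ?thesis by blast
  qed
qed

context polynomial_parametrization
begin

text \<open>If H = a b, the pullbacks of \<open>a\<close> and \<open>b\<close> to the parameter line
  multiply to 0 in an integral domain, so one factor vanishes on the whole curve. Then
  \<open>H\<close> divides that factor, and the other one is a unit.\<close>

lemma irreducible_equation_exists:
  "\<exists>H. irreducible H \<and> zero_set H = range (\<lambda>t. (t ^ n, poly q t)) \<and> coeff H n = 1 \<and>
     (\<forall>j i. coeff (coeff H j) i \<noteq> 0 \<longrightarrow> i + j \<le> n) \<and>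
     (\<forall>A. (\<forall>t. (t ^ n, poly q t) \<in> zero_set A) \<longrightarrow> H dvd A)"
proof -
  obtain H where H: "degree H = n" "coeff H n = 1"
      "\<And>j i. coeff (coeff H j) i \<noteq> 0 \<Longrightarrow> i + j \<le> n"
      "\<And>t y. poly (poly H [:y:]) (t ^ n) = (\<Prod>c\<in>roots. y - poly q (c * t))"
    using norm_polynomial_exists by blast
  have zeros: "zero_set H = range (\<lambda>t. (t ^ n, poly q t))"
  proof safe
    fix x y assume xy: "(x, y) \<in> zero_set H"
    \<comment> \<open>Any n-th root of x would do; the factor of the product that vanishes at y
      selects the right one, \<open>c * t\<close>.\<close>
    define t where "t = x powr (1 / of_nat n)"
    have "t ^ n = x"
      using n_pos by (cases "x = 0") (auto simp: t_def powr_power)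
    moreover from this have "(\<Prod>c\<in>roots. y - poly q (c * t)) = 0"
      using xy by (simp flip: H(4) add: zero_set_def)
    then obtain c where "c ^ n = 1" "y = poly q (c * t)"
      using finite_roots by (auto simp: prod_zero_iff)
    ultimately show "(x, y) \<in> range (\<lambda>t. (t ^ n, poly q t))"
      by (intro image_eqI[of _ _ "c * t"]) (auto simp: power_mult_distrib)
  next
    fix t
    show "(t ^ n, poly q t) \<in> zero_set H"
      unfolding zero_set_def using H(4) finite_roots
      by (auto intro!: prod_zero exI[of _ 1])
  qed
  have dvd: "H dvd A" if "\<And>t. (t ^ n, poly q t) \<in> zero_set A" for A
    using norm_polynomial_dvd[OF H(1,2,4) that] .
  have "H \<noteq> 0" using H n_pos by auto
  moreover have "\<not> H dvd 1"
    using H(1) n_pos by (auto simp: is_unit_poly_iff)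
  moreover have "a dvd 1 \<or> b dvd 1" if ab: "H = a * b" for a b
  proof -
    obtain Ga where Ga: "\<And>t u. poly (poly Ga [:u:]) t = poly (poly a [:poly q t + u:]) (t ^ n)"
      using substitute_param by metis
    obtain Gb where Gb: "\<And>t u. poly (poly Gb [:u:]) t = poly (poly b [:poly q t + u:]) (t ^ n)"
      using substitute_param by metis
    have "poly (poly Ga [:0:] * poly Gb [:0:]) t = 0" for t
    proof -
      have "(t ^ n, poly q t) \<in> zero_set H" using zeros by blast
      then show ?thesis by (simp add: Ga Gb ab zero_set_def del: pCons_0_0)
    qed
    then have "poly Ga [:0:] * poly Gb [:0:] = 0" using poly_all_0_iff_0 by blast
    then have "poly Ga [:0:] = 0 \<or> poly Gb [:0:] = 0" by simp
    then show ?thesis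
    proof
      assume "poly Ga [:0:] = 0"
      then have "H dvd a" using Ga[of 0] by (intro dvd) (simp add: zero_set_def)
      then show ?thesis
        using \<open>H \<noteq> 0\<close> dvd_mult_cancel_left[of a b 1] unfolding ab by simp
    next
      assume "poly Gb [:0:] = 0"
      then have "H dvd b" using Gb[of 0] by (intro dvd) (simp add: zero_set_def)
      then show ?thesis
        using \<open>H \<noteq> 0\<close> dvd_mult_cancel_right[of a b 1] unfolding ab by simp
    qed
  qed
  ultimately have "irreducible H" by (intro irreducibleI)
  then show ?thesis using zeros dvd H by (intro exI[of _ H] conjI allI impI) simp_all
qed

text \<open>\<open>H\<close> divides \<open>h\<close> and both are irreducible, so they differ by a
  nonzero constant, which changes neither zeros nor degrees.\<close>

lemma irreducible_equation:
  assumes "irreducible h" and "\<And>t. (t ^ n, poly q t) \<in> zero_set h"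
  shows "zero_set h = range (\<lambda>t. (t ^ n, poly q t))" "total_degree h = n" "\<not> infinity_point h 0 1"
proof -
  obtain H where H: "irreducible H" "zero_set H = range (\<lambda>t. (t ^ n, poly q t))" "coeff H n = 1"
     "\<And>j i. coeff (coeff H j) i \<noteq> 0 \<Longrightarrow> i + j \<le> n"
     and dvd: "\<And>A. \<forall>t. (t ^ n, poly q t) \<in> zero_set A \<Longrightarrow> H dvd A"
    using irreducible_equation_exists by blast
  have "H dvd h" using assms(2) by (intro dvd allI)
  then obtain b where b: "h = H * b" by (rule dvdE)
  have "b dvd 1"
    using irreducibleD[OF assms(1) b] H(1) by (auto simp: irreducible_def)
  then obtain c where "b = [:[:c:]:]" "c dvd 1"
    by (auto simp: is_unit_poly_iff)
  then have "c \<noteq> 0" by auto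
  have h: "h = smult [:c:] H" using b \<open>b = [:[:c:]:]\<close> by simp
  show "zero_set h = range (\<lambda>t. (t ^ n, poly q t))"
    using \<open>c \<noteq> 0\<close> by (simp flip: H(2) add: h zero_set_def)
  show "total_degree h = n" "\<not> infinity_point h 0 1"
    using total_degree_infinity_point[of h n] H(3,4) \<open>c \<noteq> 0\<close> by (auto simp: h)
qed

end

subsection \<open>Curves approaching the parametrized curve\<close>

lemma norm_power_diff_le:
  fixes z w :: "'a::real_normed_field"
  assumes "norm z \<le> r" "norm w \<le> r" "0 < r"
  shows "norm (z ^ i - w ^ i) \<le> of_nat i * r ^ (i - 1) * norm (z - w)"
proof (induction i)
  case (Suc i)
  have "z ^ Suc i - w ^ Suc i = z * (z ^ i - w ^ i) + (z - w) * w ^ i"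
    by (simp add: algebra_simps)
  then have "norm (z ^ Suc i - w ^ Suc i) \<le> norm z * norm (z ^ i - w ^ i) + norm (z - w) * norm w ^ i"
    by (metis norm_triangle_ineq norm_mult norm_power)
  also have "\<dots> \<le> r * (of_nat i * r ^ (i - 1) * norm (z - w)) + norm (z - w) * r ^ i"
    using assms by (intro add_mono mult_mono[OF _ Suc] mult_left_mono power_mono) auto
  also have "\<dots> = of_nat (Suc i) * r ^ (Suc i - 1) * norm (z - w)"
    by (cases i) (simp_all add: algebra_simps)
  finally show ?case .
qed simp

text \<open>The hypotheses give norm (t + u) <= 2 * norm t and let norm t ^ (n - 1) absorb all lower
  powers, so \<open>C\<close> is independent of t and u.\<close>

lemma poly_diff_bound:
  fixes q :: "complex poly"
  assumes "degree q \<le> n"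
  shows "\<exists>C>0. \<forall>t u. 1 \<le> norm t \<longrightarrow> norm u \<le> norm t \<longrightarrow>
    norm (poly q (t + u) - poly q t) \<le> C * norm t ^ (n - 1) * norm u"
proof -
  define C where "C = (\<Sum>i\<le>n. norm (coeff q i) * (of_nat n * 2 ^ (n - 1))) + 1"
  have C: "0 < C" unfolding C_def by (intro add_nonneg_pos sum_nonneg) auto
  have "norm (poly q (t + u) - poly q t) \<le> C * norm t ^ (n - 1) * norm u"
    if t: "1 \<le> norm t" and u: "norm u \<le> norm t" for t u
  proof -
    have le: "norm (t + u) \<le> 2 * norm t" using norm_triangle_ineq[of t u] u by simp
    have q: "poly q x = (\<Sum>i\<le>n. coeff q i * x ^ i)" for x
      using assms by (subst poly_altdef) (auto intro!: sum.mono_neutral_left le_degree)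
    have "poly q (t + u) - poly q t = (\<Sum>i\<le>n. coeff q i * ((t + u) ^ i - t ^ i))"
      by (simp add: q sum_subtractf algebra_simps)
    also have "norm \<dots> \<le> (\<Sum>i\<le>n. norm (coeff q i * ((t + u) ^ i - t ^ i)))"
      by (rule norm_sum)
    also have "\<dots> \<le> (\<Sum>i\<le>n. norm (coeff q i) * (of_nat n * 2 ^ (n - 1)) * norm t ^ (n - 1) * norm u)"
    proof (rule sum_mono)
      fix i assume i: "i \<in> {..n}"
      have "norm ((t + u) ^ i - t ^ i) \<le> of_nat i * (2 * norm t) ^ (i - 1) * norm ((t + u) - t)"
        using t le by (intro norm_power_diff_le) auto
      also have "\<dots> \<le> of_nat n * (2 * norm t) ^ (n - 1) * norm u"
        using i t by (auto intro!: mult_mono power_increasing)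
      finally show "norm (coeff q i * ((t + u) ^ i - t ^ i)) \<le>
          norm (coeff q i) * (of_nat n * 2 ^ (n - 1)) * norm t ^ (n - 1) * norm u"
        by (simp add: norm_mult power_mult_distrib mult.assoc mult_left_mono)
    qed
    also have "\<dots> = (C - 1) * norm t ^ (n - 1) * norm u"
      by (simp add: C_def sum_distrib_right)
    also have "\<dots> \<le> C * norm t ^ (n - 1) * norm u"
      by (intro mult_right_mono) auto
    finally show ?thesis .
  qed
  with C show ?thesis by blast
qed

text \<open>The displacement is a root of (t + u) ^ n - x as a polynomial in u. Its linear
  coefficient is n * t ^ (n - 1) and its constant one t ^ n - x, so \<open>weighted_coeff_le\<close>
  at index 1 excludes that all roots have norm at least \<open>e\<close>.\<close>

lemma nearby_power_root:
  fixes t x :: complex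
  assumes "0 < n" "0 < e" "2 ^ n * norm (t ^ n - x) < e * norm t ^ (n - 1)"
  shows "\<exists>u. norm u < e \<and> (t + u) ^ n = x"
proof (rule ccontr)
  assume none: "\<not> ?thesis"
  define p where "p = [:t, 1:] ^ n - [:x:]"
  have p: "poly p u = (t + u) ^ n - x" for u by (simp add: p_def)
  have c1: "coeff p 1 = of_nat n * t ^ (n - 1)"
    using assms(1) coeff_linear_poly_power[of 1 n t 1] by (simp add: p_def)
  have c0: "coeff p 0 = t ^ n - x"
    by (simp add: p flip: poly_0_coeff_0)
  have deg: "degree p \<le> n"
    unfolding p_def by (intro degree_diff_le) (auto simp: degree_linear_power)
  have "norm (coeff p 1) * e ^ 1 \<le> 2 ^ degree p * norm (coeff p 0)"
    using none p by (intro weighted_coeff_le assms(2)) (auto simp: not_less)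
  also have "\<dots> \<le> 2 ^ n * norm (coeff p 0)"
    by (intro mult_right_mono power_increasing deg) auto
  also have "\<dots> < e * norm t ^ (n - 1)" using assms(3) c0 by simp
  also have "\<dots> \<le> of_nat n * (e * norm t ^ (n - 1))"
    using assms(1,2) mult_right_mono[of 1 "of_nat n" "e * norm t ^ (n - 1)"] by simp
  finally show False using c1 by (simp add: norm_mult norm_power mult_ac)
qed

text \<open>Changing t ^ n by a fixed amount moves t by the order of norm t ^ (1 - n), while q
  varies at a rate of order at most norm t ^ (n - 1). The powers cancel, so \<open>d\<close> can be
  chosen independently of t.\<close>

lemma nearby_parameter:
  fixes q :: "complex poly"
  assumes "0 < n" "degree q \<le> n" "0 < e"
  shows "\<exists>d>0. \<exists>b. \<forall>t x. b \<le> norm t \<longrightarrow> norm (x - t ^ n) < d \<longrightarrow>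
    (\<exists>s. s ^ n = x \<and> norm (poly q s - poly q t) < e)"
proof -
  obtain C where C: "0 < C" "\<And>t u. 1 \<le> norm t \<Longrightarrow> norm u \<le> norm t \<Longrightarrow>
    norm (poly q (t + u) - poly q t) \<le> C * norm t ^ (n - 1) * norm u"
    using poly_diff_bound[OF assms(2)] by blast
  \<comment> \<open>This makes 2 ^ n * d equal to k * norm t ^ (n - 1), the threshold in
    \<open>nearby_power_root\<close> for the displacement bound \<open>k\<close> below.\<close>
  define d where "d = e / (C * 2 ^ n)"
  \<comment> \<open>Since k <= e / C, this forces norm u <= norm t, as
    \<open>poly_diff_bound\<close> requires.\<close>
  define b where "b = max 1 (e / C)"
  have "0 < d" using assms C by (simp add: d_def)
  moreover have "\<exists>s. s ^ n = x \<and> norm (poly q s - poly q t) < e"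
    if t: "b \<le> norm t" and x: "norm (x - t ^ n) < d" for t x
  proof -
    have t1: "1 \<le> norm t" "e / C \<le> norm t" using t by (auto simp: b_def)
    define k where "k = e / (C * norm t ^ (n - 1))"
    have "t \<noteq> 0" using t1(1) by auto
    then have pos: "0 < norm t ^ (n - 1)" by simp
    have k: "0 < k" using assms C pos by (simp add: k_def)
    have "2 ^ n * norm (t ^ n - x) < 2 ^ n * d"
      using x by (simp add: norm_minus_commute)
    also have "\<dots> = k * norm t ^ (n - 1)" using \<open>t \<noteq> 0\<close> by (simp add: d_def k_def)
    finally obtain u where u: "norm u < k" "(t + u) ^ n = x"
      using nearby_power_root[OF assms(1) k] by blast
    have "k \<le> e / C"
    proof -
      have "1 \<le> norm t ^ (n - 1)" using t1(1) by (rule one_le_power)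
      then have "C * 1 \<le> C * norm t ^ (n - 1)" using C(1) by (intro mult_left_mono) auto
      then show ?thesis unfolding k_def using assms(3) C(1) by (intro divide_left_mono) auto
    qed
    then have "norm u \<le> norm t" using u(1) t1 by linarith
    then have "norm (poly q (t + u) - poly q t) \<le> C * norm t ^ (n - 1) * norm u"
      using t1 C by blast
    also have "\<dots> < C * norm t ^ (n - 1) * k"
      using u(1) C(1) pos by (intro mult_strict_left_mono) auto
    also have "\<dots> = e" using C(1) \<open>t \<noteq> 0\<close> by (simp add: k_def)
    finally show ?thesis using u(2) by blast
  qed
  ultimately show ?thesis by blast
qed

lemma infdist_less_imp_ex:
  assumes "A \<noteq> {}" "infdist x A < e"
  shows "\<exists>a\<in>A. dist x a < e"
  using assms by (subst (asm) infdist_notempty) (auto simp: cINF_less_iff)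

text \<open>The nearby point (x, y) of g need not have first coordinate t ^ n. Passing to a
  parameter s with s ^ n = x makes the first coordinates agree and turns closeness in the plane into
  a small root u = y - q s.\<close>

lemma (in polynomial_parametrization) degree_ge_if_approached:
  fixes g :: "complex poly poly"
  assumes "irreducible g"
    and near: "\<And>e b. 0 < e \<Longrightarrow> \<exists>t. b \<le> norm (t ^ n) \<and> infdist (t ^ n, poly q t) (zero_set g) < e"
  shows "n \<le> total_degree g"
proof (rule ccontr)
  assume "\<not> n \<le> total_degree g"
  then have deg: "degree g < n" using degree_le_total_degree[of g] by simp
  obtain G where G: "\<And>t u. poly (poly G [:u:]) t = poly (poly g [:poly q t + u:]) (t ^ n)"
    using substitute_param by metis
  have freq: "\<exists>\<^sub>F t in at_infinity. \<exists>u. norm u < e \<and> poly (poly G [:u:]) t = 0" if e: "0 < e" for e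
  proof -
    obtain d b where d: "0 < d" "\<And>t x. b \<le> norm t \<Longrightarrow> norm (x - t ^ n) < d \<Longrightarrow>
        \<exists>s. s ^ n = x \<and> norm (poly q s - poly q t) < e / 2"
      using nearby_parameter[OF n_pos degree_q half_gt_zero[OF e]] by blast
    have "\<exists>s. a \<le> norm s \<and> (\<exists>u. norm u < e \<and> poly (poly G [:u:]) s = 0)" for a
    proof -
      \<comment> \<open>Nonnegativity is used to compare n-th powers; \<open>b\<close> admits
        \<open>nearby_parameter\<close> and \<open>a\<close> is the bound wanted for s.\<close>
      define c where "c = max 0 (max b a)"
      \<comment> \<open>The summand 1 pays for the move from t ^ n to x, which is shorter than 1, so
        that c <= norm s still holds.\<close>
      obtain t where t: "c ^ n + 1 \<le> norm (t ^ n)"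
          "infdist (t ^ n, poly q t) (zero_set g) < min (min d 1) (e / 2)"
        using near[of "min (min d 1) (e / 2)" "c ^ n + 1"] d(1) e by auto
      obtain x y where xy: "(x, y) \<in> zero_set g" and dist: "dist (t ^ n, poly q t) (x, y) < min (min d 1) (e / 2)"
        using infdist_less_imp_ex[OF zero_set_nonempty[OF assms(1)] t(2)] by auto
      have x: "norm (x - t ^ n) < min (min d 1) (e / 2)"
        using dist_fst_le[of "(t ^ n, poly q t)" "(x, y)"] dist by (simp add: dist_norm norm_minus_commute)
      have y: "norm (y - poly q t) < e / 2"
        using dist_snd_le[of "(t ^ n, poly q t)" "(x, y)"] dist by (simp add: dist_norm norm_minus_commute)
      have "c ^ n \<le> norm t ^ n" using t(1) by (simp add: norm_power)
      then have "c \<le> norm t" using n_pos by (subst (asm) power_mono_iff) (auto simp: c_def)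
      then obtain s where s: "s ^ n = x" "norm (poly q s - poly q t) < e / 2"
        using d(2)[of t x] x by (auto simp: c_def)
      have "norm (t ^ n) \<le> norm (x - t ^ n) + norm x"
        by (metis norm_minus_commute norm_triangle_sub add.commute)
      then have "c ^ n \<le> norm s ^ n" using t(1) x s(1) by (simp flip: norm_power)
      then have "c \<le> norm s" using n_pos by (subst (asm) power_mono_iff) (auto simp: c_def)
      then have "a \<le> norm s" by (simp add: c_def)
      moreover have "norm (y - poly q s) < e"
      proof -
        have "norm (y - poly q s) = norm ((y - poly q t) - (poly q s - poly q t))" by simp
        also have "\<dots> \<le> norm (y - poly q t) + norm (poly q s - poly q t)" by (rule norm_triangle_ineq4)
        finally show ?thesis using y s(2) by simp
      qed
      moreover have "poly (poly G [:y - poly q s:]) s = 0"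
        using xy by (simp add: G s(1) zero_set_def)
      ultimately show ?thesis by blast
    qed
    then show ?thesis unfolding frequently_def eventually_at_infinity by blast
  qed
  have "g = 0"
    using small_root_frequently_imp_eventually[OF freq]
    by (intro eq_0_if_roots_near_conjugates deg) (simp add: G)
  then show False using assms(1) by simp
qed

subsection \<open>Leaves of infinity branches\<close>

lemma powr_neg_root_power:
  fixes z :: complex
  assumes "z \<noteq> 0" "0 < N"
  shows "(z powr (- 1 / of_nat N)) ^ N = inverse z"
  using assms by (subst powr_power) (simp_all add: powr_minus)

text \<open>The series converges at a real x strictly between M and norm z, where its argument has
  larger modulus. This gives the strict inequality needed for evaluation inside the open
  disc.\<close>

lemma branch_conv_radius:
  fixes z c :: complex
  assumes "branch_series h m N \<phi> M" "M < norm z" "norm c = 1"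
  shows "ereal (norm (c * z powr (- 1 / of_nat N))) < fps_conv_radius \<phi>"
proof -
  have M: "0 < M" "0 < N" using assms(1) by (auto simp: branch_series_def)
  define x where "x = (M + norm z) / 2"
  have x: "M < x" "x < norm z" using assms(2) by (auto simp: x_def)
  have sm: "summable (\<lambda>i. fps_nth \<phi> i * (of_real x powr (- 1 / of_nat N)) ^ i)"
    using assms(1) x M by (auto simp: branch_series_def)
  have norm_powr: "norm (z powr (- 1 / of_nat N)) = norm z powr (- 1 / of_nat N)" for z :: complex
    by (subst norm_powr_real_powr') (auto intro!: Reals_divide)
  have "norm (c * z powr (- 1 / of_nat N)) < norm (of_real x powr (- 1 / of_nat N) :: complex)"
    using x M assms(3) by (simp only: norm_mult norm_powr mult_1) (auto intro!: powr_less_mono2_neg)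
  also have "ereal \<dots> \<le> fps_conv_radius \<phi>"
    unfolding fps_conv_radius_def by (rule conv_radius_geI[OF sm])
  finally show ?thesis by simp
qed

section \<open>Substituting a branch into the equation of its curve\<close>

lemma eval_fps_sum:
  fixes F :: "'b \<Rightarrow> 'a::{banach, real_normed_div_algebra, comm_ring_1} fps"
  assumes "\<And>i. i \<in> A \<Longrightarrow> ereal (norm z) < fps_conv_radius (F i)"
  shows "ereal (norm z) < fps_conv_radius (sum F A) \<and> eval_fps (sum F A) z = (\<Sum>i\<in>A. eval_fps (F i) z)"
  using assms
proof (induction A rule: infinite_finite_induct)
  case (insert i A)
  then have IH: "ereal (norm z) < fps_conv_radius (sum F A)" "ereal (norm z) < fps_conv_radius (F i)"
    "eval_fps (sum F A) z = (\<Sum>i\<in>A. eval_fps (F i) z)" by auto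
  then have "ereal (norm z) < min (fps_conv_radius (F i)) (fps_conv_radius (sum F A))" by simp
  also have "\<dots> \<le> fps_conv_radius (F i + sum F A)" by (rule fps_conv_radius_add)
  finally show ?case using IH insert.hyps by (simp add: eval_fps_add)
qed auto

lemma less_fps_conv_radius_mult:
  fixes f g :: "'a::{banach, real_normed_div_algebra, comm_ring_1} fps"
  assumes "ereal r < fps_conv_radius f" "ereal r < fps_conv_radius g"
  shows "ereal r < fps_conv_radius (f * g)"
  using assms fps_conv_radius_mult[of f g] by (metis less_le_trans min_less_iff_conj)

lemma less_fps_conv_radius_power:
  fixes f :: "'a::{banach, real_normed_div_algebra, comm_ring_1} fps"
  assumes "ereal r < fps_conv_radius f"
  shows "ereal r < fps_conv_radius (f ^ n)"
  using assms fps_conv_radius_power[of f n] by (rule less_le_trans)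

text \<open>Turns the formal identity defining a branch into an identity of complex numbers; every
  series occurring is kept inside its disc of convergence, where evaluation is a ring
  homomorphism.\<close>

lemma eval_fps_homogenization:
  fixes \<phi> :: "complex fps"
  assumes r: "ereal (norm s) < fps_conv_radius \<phi>"
  shows "eval_fps (homogenization fps_const h 1 \<phi> (fps_X ^ N)) s =
    homogenization (\<lambda>c. c) h 1 (eval_fps \<phi> s) (s ^ N)"
proof -
  define T :: "nat \<Rightarrow> nat \<Rightarrow> complex fps" where
    "T l j = fps_const (coeff (coeff h j) (l - j)) * 1 ^ (l - j) * \<phi> ^ j" for l j
  have T: "ereal (norm s) < fps_conv_radius (T l j)" for l j
    unfolding T_def power_one mult_1_right
    by (intro less_fps_conv_radius_mult less_fps_conv_radius_power r) simp
  have eval_T: "eval_fps (T l j) s = coeff (coeff h j) (l - j) * eval_fps \<phi> s ^ j" for l j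
    unfolding T_def power_one mult_1_right
    by (subst eval_fps_mult) (use r in \<open>simp_all add: less_fps_conv_radius_power eval_fps_power\<close>)
  define S where "S l = (\<Sum>j\<le>l. T l j)" for l
  have S: "ereal (norm s) < fps_conv_radius (S l)"
     "eval_fps (S l) s = (\<Sum>j\<le>l. coeff (coeff h j) (l - j) * eval_fps \<phi> s ^ j)" for l
    using eval_fps_sum[of "{..l}" s "T l"] T by (auto simp: S_def eval_T)
  have X: "ereal (norm s) < fps_conv_radius ((fps_X ^ N) ^ k :: complex fps)" for k
    by (intro less_fps_conv_radius_power) simp
  have "homogenization fps_const h 1 \<phi> (fps_X ^ N) =
      (\<Sum>l\<le>total_degree h. (fps_X ^ N) ^ (total_degree h - l) * S l)"
    by (simp add: homogenization_def homog_part_def S_def T_def)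
  also have "eval_fps \<dots> s = (\<Sum>l\<le>total_degree h. eval_fps ((fps_X ^ N) ^ (total_degree h - l) * S l) s)"
    using X S by (intro conjunct2[OF eval_fps_sum] less_fps_conv_radius_mult)
  also have "\<dots> = (\<Sum>l\<le>total_degree h. (s ^ N) ^ (total_degree h - l) *
      (\<Sum>j\<le>l. coeff (coeff h j) (l - j) * eval_fps \<phi> s ^ j))"
    using X S by (intro sum.cong refl) (simp add: eval_fps_mult eval_fps_power)
  finally show ?thesis by (simp add: homogenization_def homog_part_def)
qed

text \<open>With w = 1 / z, a monomial of degree l contributes z ^ l = z ^ D * w ^ (D - l), where D
  is the total degree.\<close>

lemma poly_poly_eq_homogenization:
  assumes "z * w = 1"
  shows "poly (poly h [:z * y:]) z = z ^ total_degree h * homogenization (\<lambda>c. c) h 1 y w"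
proof -
  let ?D = "total_degree h"
  have "poly (poly h [:z * y:]) z = (\<Sum>j\<le>degree h. poly (coeff h j) z * (z * y) ^ j)"
    by (subst poly_altdef) (simp add: poly_sum)
  also have "\<dots> = (\<Sum>j\<le>?D. poly (coeff h j) z * (z * y) ^ j)"
    using degree_le_total_degree[of h]
    by (intro sum.mono_neutral_left) (auto simp: coeff_eq_0)
  \<comment> \<open>The inner index becomes the total degree l = i + j, so that exchanging the two
    sums collects homogeneous parts.\<close>
  also have "\<dots> = (\<Sum>j\<le>?D. \<Sum>l\<in>{j..?D}. coeff (coeff h j) (l - j) * z ^ l * y ^ j)"
  proof (intro sum.cong refl)
    fix j assume j: "j \<in> {..?D}"
    have "poly (coeff h j) z = (\<Sum>i\<le>?D - j. coeff (coeff h j) i * z ^ i)"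
    proof (subst poly_altdef, intro sum.mono_neutral_left ballI)
      show "{..degree (coeff h j)} \<subseteq> {..?D - j}"
      proof (cases "coeff h j = 0")
        case False
        then have "coeff (coeff h j) (degree (coeff h j)) \<noteq> 0" by simp
        from le_total_degree[OF this] show ?thesis by auto
      qed auto
    qed (auto simp: coeff_eq_0)
    also have "\<dots> = (\<Sum>l\<in>{j..?D}. coeff (coeff h j) (l - j) * z ^ (l - j))"
      using j by (intro sum.reindex_bij_witness[of _ "\<lambda>l. l - j" "\<lambda>i. i + j"]) auto
    finally have "poly (coeff h j) z * (z * y) ^ j =
        (\<Sum>l\<in>{j..?D}. coeff (coeff h j) (l - j) * z ^ (l - j) * (z * y) ^ j)"
      by (simp add: sum_distrib_right)
    also have "\<dots> = (\<Sum>l\<in>{j..?D}. coeff (coeff h j) (l - j) * z ^ l * y ^ j)"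
    proof (intro sum.cong refl)
      fix l assume "l \<in> {j..?D}"
      then have "z ^ l = z ^ (l - j) * z ^ j" by (simp flip: power_add)
      then show "coeff (coeff h j) (l - j) * z ^ (l - j) * (z * y) ^ j =
          coeff (coeff h j) (l - j) * z ^ l * y ^ j"
        by (simp add: power_mult_distrib)
    qed
    finally show "poly (coeff h j) z * (z * y) ^ j =
        (\<Sum>l\<in>{j..?D}. coeff (coeff h j) (l - j) * z ^ l * y ^ j)" .
  qed
  also have "\<dots> = (\<Sum>l\<le>?D. \<Sum>j\<le>l. coeff (coeff h j) (l - j) * z ^ l * y ^ j)"
  proof -
    have "(\<Sum>j\<le>?D. \<Sum>l\<in>{j..?D}. coeff (coeff h j) (l - j) * z ^ l * y ^ j) =
        (\<Sum>j\<le>?D. \<Sum>l | l \<in> {..?D} \<and> j \<le> l. coeff (coeff h j) (l - j) * z ^ l * y ^ j)"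
      by (intro sum.cong refl) auto
    also have "\<dots> = (\<Sum>l\<le>?D. \<Sum>j | j \<in> {..?D} \<and> j \<le> l. coeff (coeff h j) (l - j) * z ^ l * y ^ j)"
      by (rule sum.swap_restrict) auto
    also have "\<dots> = (\<Sum>l\<le>?D. \<Sum>j\<le>l. coeff (coeff h j) (l - j) * z ^ l * y ^ j)"
      by (intro sum.cong refl) auto
    finally show ?thesis .
  qed
  also have "\<dots> = z ^ ?D * homogenization (\<lambda>c. c) h 1 y w"
    unfolding homogenization_def homog_part_def sum_distrib_left
  proof (intro sum.cong refl)
    fix l j assume l: "l \<in> {..?D}"
    have "z ^ ?D * w ^ (?D - l) = z ^ l * (z * w) ^ (?D - l)"
      using l by (simp add: power_mult_distrib flip: power_add mult.assoc)
    then have "z ^ ?D * w ^ (?D - l) = z ^ l" using assms by simp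
    then show "coeff (coeff h j) (l - j) * z ^ l * y ^ j =
        z ^ ?D * (w ^ (?D - l) * (coeff (coeff h j) (l - j) * 1 ^ (l - j) * y ^ j))"
      by (simp flip: \<open>z ^ ?D * w ^ (?D - l) = z ^ l\<close>)
  qed
  finally show ?thesis .
qed

text \<open>Whichever root of unity \<open>c\<close> is taken, s = c * z powr (- 1 / N) satisfies s
  ^ N = 1 / z, so the branch identity may be evaluated at s.\<close>

lemma leaf_in_zero_set:
  assumes "branch_series h m N \<phi> M" "M < norm z" "c ^ N = 1"
  shows "(z, leaf_fun N \<phi> c z) \<in> zero_set h"
proof -
  have N: "0 < N" "0 < M" and hom: "homogenization fps_const h 1 \<phi> (fps_X ^ N) = 0"
    using assms(1) by (auto simp: branch_series_def)
  have "norm c ^ N = 1" using assms(3) by (simp flip: norm_power)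
  then have c: "norm c = 1" using N power_eq_imp_eq_base[of "norm c" N 1] by simp
  define s where "s = c * z powr (- 1 / of_nat N)"
  have "z \<noteq> 0" using assms(2) N by auto
  then have "z * s ^ N = 1"
    by (simp only: s_def power_mult_distrib assms(3) powr_neg_root_power[OF \<open>z \<noteq> 0\<close> N(1)]) simp
  then have "poly (poly h [:z * eval_fps \<phi> s:]) z =
      z ^ total_degree h * homogenization (\<lambda>c. c) h 1 (eval_fps \<phi> s) (s ^ N)"
    by (rule poly_poly_eq_homogenization)
  also have "homogenization (\<lambda>c. c) h 1 (eval_fps \<phi> s) (s ^ N) = 0"
    using eval_fps_homogenization[of s \<phi> h N] hom branch_conv_radius[OF assms(1,2) c]
    by (simp add: s_def)
  finally show ?thesis by (simp add: zero_set_def leaf_fun_def s_def)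
qed

text \<open>The terms beyond index \<open>N\<close> sum to z * s ^ (N + 1) * psi(s) = s * psi(s),
  because z * s ^ N = 1. This tends to 0 as s does, psi being continuous at 0.\<close>

lemma leaf_fun_tendsto:
  assumes "branch_series h m N \<phi> M"
  shows "((\<lambda>z. leaf_fun N \<phi> 1 z - z * (\<Sum>i\<le>N. fps_nth \<phi> i * (z powr (- 1 / of_nat N)) ^ i)) \<longlongrightarrow> 0) at_infinity"
proof -
  have N: "0 < N" "0 < M" using assms(1) by (auto simp: branch_series_def)
  define s where "s z = z powr (- 1 / of_nat N)" for z :: complex
  \<comment> \<open>The shift is by \<open>Suc N\<close> because index \<open>N\<close> is the
    constant term of the leaf, which does not tend to 0.\<close>
  define \<psi> where "\<psi> = fps_shift (Suc N) \<phi>"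
  have "norm (s z) = norm z powr (- 1 / of_nat N)" for z
    unfolding s_def by (subst norm_powr_real_powr') (auto intro!: Reals_divide)
  moreover have "((\<lambda>z::complex. norm z powr (- 1 / of_nat N)) \<longlongrightarrow> 0) at_infinity"
    using N by (intro tendsto_neg_powr filterlim_norm_at_top) auto
  ultimately have s: "(s \<longlongrightarrow> 0) at_infinity"
    by (subst tendsto_norm_zero_iff[symmetric]) simp
  define z0 :: complex where "z0 = of_real (M + 1)"
  have "M < norm z0" using N by (simp add: z0_def del: of_real_add)
  from branch_conv_radius[OF assms this, of 1] have "0 < fps_conv_radius \<phi>"
    by (metis ereal_less_eq(5) le_less_trans norm_ge_zero norm_one)
  then have "isCont (eval_fps \<psi>) 0"
    by (intro continuous_eval_fps continuous_ident) (auto simp: \<psi>_def zero_ereal_def)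
  then have "((\<lambda>z. s z * eval_fps \<psi> (s z)) \<longlongrightarrow> 0 * eval_fps \<psi> 0) at_infinity"
    by (intro tendsto_mult s isCont_tendsto_compose[OF _ s])
  then have "((\<lambda>z. s z * eval_fps \<psi> (s z)) \<longlongrightarrow> 0) at_infinity" by simp
  then show ?thesis
  proof (rule Lim_transform_eventually)
    have "\<forall>\<^sub>F z::complex in at_infinity. M < norm z"
      unfolding eventually_at_infinity by (intro exI[of _ "M + 1"]) auto
    then show "\<forall>\<^sub>F z in at_infinity. s z * eval_fps \<psi> (s z) =
        leaf_fun N \<phi> 1 z - z * (\<Sum>i\<le>N. fps_nth \<phi> i * (z powr (- 1 / of_nat N)) ^ i)"
    proof eventually_elim
      case (elim z)
      have r: "ereal (norm (s z)) < fps_conv_radius \<phi>"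
        using branch_conv_radius[OF assms elim, of 1] by (simp add: s_def)
      have "z \<noteq> 0" using elim N by auto
      then have sN: "z * s z ^ N = 1"
        by (simp only: s_def powr_neg_root_power[OF \<open>z \<noteq> 0\<close> N(1)]) simp
      have "eval_fps \<phi> (s z) = (\<Sum>i. fps_nth \<phi> (i + Suc N) * s z ^ (i + Suc N)) + (\<Sum>i<Suc N. fps_nth \<phi> i * s z ^ i)"
        unfolding eval_fps_def by (rule suminf_split_initial_segment[OF summable_fps[OF r]])
      also have "(\<Sum>i. fps_nth \<phi> (i + Suc N) * s z ^ (i + Suc N)) = (\<Sum>i. s z ^ Suc N * (fps_nth \<psi> i * s z ^ i))"
        by (simp add: \<psi>_def power_add mult_ac)
      also have "\<dots> = s z ^ Suc N * eval_fps \<psi> (s z)"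
        unfolding eval_fps_def using r by (intro suminf_mult summable_fps) (simp add: \<psi>_def)
      finally have "z * eval_fps \<phi> (s z) =
          (z * s z ^ N) * s z * eval_fps \<psi> (s z) + z * (\<Sum>i\<le>N. fps_nth \<phi> i * s z ^ i)"
        by (simp add: algebra_simps lessThan_Suc_atMost)
      moreover have "leaf_fun N \<phi> 1 z = z * eval_fps \<phi> (s z)"
        by (simp add: leaf_fun_def s_def)
      ultimately show ?case unfolding s_def[symmetric] using sN by simp
    qed
  qed
qed

subsection \<open>The asymptote\<close>

text \<open>Every leaf of every infinity branch lies on the curve, so its points have the form (t ^
  n, q t). Approach at any branch thus supplies parameters with t ^ n arbitrarily large, and the
  degree bound applies.\<close>

lemma (in polynomial_parametrization) perfect_curve_if_param:
  assumes "irreducible h" and "\<And>t. (t ^ n, poly q t) \<in> zero_set h"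
  shows "perfect_curve h"
  unfolding perfect_curve_def
proof (intro conjI allI impI notI)
  show "irreducible h" by fact
  show False if "infinity_point h 0 1" using irreducible_equation[OF assms] that by blast
next
  fix m' B assume "\<exists>g. irreducible g \<and> total_degree g < total_degree h \<and> approaches g h B"
  then obtain g m N \<phi> M c where g: "irreducible g" "total_degree g < n"
    and br: "branch_series h m N \<phi> M" and c: "c ^ N = 1"
    and lim: "((\<lambda>z. infdist (z, leaf_fun N \<phi> c z) (zero_set g)) \<longlongrightarrow> 0) at_infinity"
    using irreducible_equation(2)[OF assms] unfolding approaches_def by auto
  have "\<exists>t. b \<le> norm (t ^ n) \<and> infdist (t ^ n, poly q t) (zero_set g) < e" if "0 < e" for e b
  proof -
    have "\<forall>\<^sub>F z::complex in at_infinity. max (M + 1) b \<le> norm z"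
      unfolding eventually_at_infinity by blast
    moreover have "\<forall>\<^sub>F z in at_infinity. infdist (z, leaf_fun N \<phi> c z) (zero_set g) < e"
      using lim that by (rule order_tendstoD)
    ultimately have "\<forall>\<^sub>F z::complex in at_infinity. \<exists>t. b \<le> norm (t ^ n) \<and> infdist (t ^ n, poly q t) (zero_set g) < e"
    proof eventually_elim
      case (elim z)
      then have "(z, leaf_fun N \<phi> c z) \<in> zero_set h" by (intro leaf_in_zero_set[OF br _ c]) simp
      then obtain t where "z = t ^ n" "leaf_fun N \<phi> c z = poly q t"
        unfolding irreducible_equation(1)[OF assms] by auto
      with elim show ?case by (intro exI[of _ t]) simp
    qed
    then show ?thesis by (simp add: trivial_limit_at_infinity)
  qed
  then have "n \<le> total_degree g" using g(1) by (intro degree_ge_if_approached)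
  then show False using g(2) by simp
qed

text \<open>The two sums may use different denominators \<open>N\<close> and \<open>n\<close>, so
  they are compared through the set of pairs of exponent and coefficient, which both index
  injectively.\<close>

lemma leaf_polynomial_part:
  fixes \<phi> :: "complex fps" and \<nu> :: "nat \<Rightarrow> nat" and a :: "nat \<Rightarrow> complex"
  assumes "0 < N" "0 < n" "z \<noteq> 0" "inj_on \<nu> {1..k}"
    and terms: "{(q, c) \<in> branch_terms N \<phi>. 0 \<le> q} =
           (\<lambda>j. (1 - of_nat (\<nu> j) / of_nat n, a j)) ` {1..k}"
  shows "z * (\<Sum>i\<le>N. fps_nth \<phi> i * (z powr (- 1 / of_nat N)) ^ i) =
    fps_nth \<phi> 0 * z + (\<Sum>j=1..k. a j * z powr (1 - of_nat (\<nu> j) / of_nat n))"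
proof -
  define F :: "rat \<times> complex \<Rightarrow> complex" where "F = (\<lambda>(q, c). c * z powr (of_rat q))"
  define I where "I = {i. 0 < i \<and> i \<le> N \<and> fps_nth \<phi> i \<noteq> 0}"
  have F_eq: "F (1 - of_nat i / of_nat d, c) = c * z powr (1 - of_nat i / of_nat d)" for i d c
    by (simp add: F_def of_rat_diff of_rat_divide)
  have pow: "z * (z powr (- 1 / of_nat N)) ^ i = z powr (1 - of_nat i / of_nat N)" for i
  proof -
    have "(z powr (- 1 / of_nat N)) ^ i = z powr (- (of_nat i / of_nat N))"
      using assms(3) by (subst powr_power) simp_all
    then show ?thesis
      using assms(3) powr_add[of z 1 "- (of_nat i / of_nat N)"] by simp
  qed
  have "{(q, c) \<in> branch_terms N \<phi>. 0 \<le> q} = (\<lambda>i. (1 - of_nat i / of_nat N, fps_nth \<phi> i)) ` I"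
    using assms(1) by (auto simp: branch_terms_def I_def)
  with terms have img: "(\<lambda>i. (1 - of_nat i / of_nat N :: rat, fps_nth \<phi> i)) ` I =
      (\<lambda>j. (1 - of_nat (\<nu> j) / of_nat n, a j)) ` {1..k}" by simp
  have inj: "inj_on (\<lambda>j. (1 - of_nat (\<nu> j) / of_nat n :: rat, a j)) {1..k}"
  proof (rule inj_onI)
    fix i j assume "i \<in> {1..k}" "j \<in> {1..k}"
      and "(1 - of_nat (\<nu> i) / of_nat n :: rat, a i) = (1 - of_nat (\<nu> j) / of_nat n, a j)"
    moreover from this have "\<nu> i = \<nu> j" using assms(2) by simp
    ultimately show "i = j" using inj_onD[OF assms(4)] by blast
  qed
  \<comment> \<open>Index 0 is the linear term, which \<open>branch_terms\<close> leaves out; it is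
    split off here.\<close>
  have "(\<Sum>i\<le>N. fps_nth \<phi> i * (z powr (- 1 / of_nat N)) ^ i) =
      (\<Sum>i\<in>insert 0 I. fps_nth \<phi> i * (z powr (- 1 / of_nat N)) ^ i)"
    by (rule sum.mono_neutral_right) (auto simp: I_def)
  also have "z * \<dots> = fps_nth \<phi> 0 * z + (\<Sum>i\<in>I. F (1 - of_nat i / of_nat N, fps_nth \<phi> i))"
  proof -
    have "finite I" "0 \<notin> I" by (auto simp: I_def)
    then show ?thesis
      by (simp add: distrib_left sum_distrib_left F_eq mult.left_commute[of z] flip: pow)
  qed
  also have "(\<Sum>i\<in>I. F (1 - of_nat i / of_nat N, fps_nth \<phi> i)) =
      sum F ((\<lambda>i. (1 - of_nat i / of_nat N, fps_nth \<phi> i)) ` I)"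
    using assms(1) by (subst sum.reindex) (auto intro!: inj_onI)
  also have "\<dots> = (\<Sum>j=1..k. F (1 - of_nat (\<nu> j) / of_nat n, a j))"
    unfolding img by (subst sum.reindex[OF inj]) simp
  finally show ?thesis by (simp add: F_eq)
qed

section \<open>The truncated series as a polynomial parametrization\<close>

definition param_poly :: "complex \<Rightarrow> nat \<Rightarrow> nat \<Rightarrow> (nat \<Rightarrow> nat) \<Rightarrow> (nat \<Rightarrow> complex) \<Rightarrow> complex poly" where
  "param_poly m n k \<nu> a = monom m n + (\<Sum>j=1..k. monom (a j) (n - \<nu> j))"

lemma poly_param_poly:
  "poly (param_poly m n k \<nu> a) t = m * t ^ n + (\<Sum>j=1..k. a j * t ^ (n - \<nu> j))"
  by (simp add: param_poly_def poly_sum poly_monom)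

text \<open>Equal conjugates give c ^ (n - \<open>\<nu> j\<close>) = c' ^ (n -
  \<open>\<nu> j\<close>) by comparing coefficients. Since c ^ n = c' ^ n, the quotient c / c' is a
  root of unity for n and for every \<open>\<nu> j\<close>, hence equal to 1 by the gcd
  condition.\<close>

lemma polynomial_parametrization_param_poly:
  assumes a: "\<And>j. j \<in> {1..k} \<Longrightarrow> a j \<noteq> 0" and "0 < n"
    and \<nu>: "\<And>j. j \<in> {1..k} \<Longrightarrow> 0 < \<nu> j \<and> \<nu> j \<le> n" and inj: "inj_on \<nu> {1..k}"
    and gcd: "Gcd (insert n (\<nu> ` {1..k})) = 1"
  shows "polynomial_parametrization n (param_poly m n k \<nu> a)"
proof
  let ?q = "param_poly m n k \<nu> a"
  show "0 < n" by fact
  show "degree ?q \<le> n"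
    unfolding param_poly_def
    by (intro degree_add_le degree_sum_le order_trans[OF degree_monom_le]) auto
  fix c c' :: complex
  assume c: "c ^ n = 1" "c' ^ n = 1" and eq: "pcompose ?q [:0, c:] = pcompose ?q [:0, c':]"
  have "c' \<noteq> 0" using c(2) \<open>0 < n\<close> by (auto simp: power_0_left)
  have "(c / c') ^ i = 1" if "i \<in> insert n (\<nu> ` {1..k})" for i
  proof (cases "i = n")
    case True
    then show ?thesis using c by (simp add: power_divide)
  next
    case False
    then obtain j where j: "j \<in> {1..k}" "i = \<nu> j" using \<open>i \<in> _\<close> by blast
    \<comment> \<open>Injectivity of \<open>\<nu>\<close> prevents two terms from sharing a degree,
      and 0 < \<open>\<nu> j\<close> separates them from the term of degree n.\<close>
    have "coeff ?q (n - \<nu> j) = (\<Sum>l=1..k. if l = j then a l else 0)"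
    proof -
      have "n - \<nu> l = n - \<nu> j \<longleftrightarrow> l = j" if "l \<in> {1..k}" for l
        using \<nu>[OF that] \<nu>[OF j(1)] inj_onD[OF inj _ that j(1)] by auto
      then show ?thesis
        using \<nu>[OF j(1)] \<open>0 < n\<close> by (auto simp: param_poly_def coeff_sum intro!: sum.cong)
    qed
    then have "coeff ?q (n - \<nu> j) = a j" using j(1) by simp
    moreover have "c ^ (n - \<nu> j) * coeff ?q (n - \<nu> j) = c' ^ (n - \<nu> j) * coeff ?q (n - \<nu> j)"
      using arg_cong[OF eq, of "\<lambda>p. coeff p (n - \<nu> j)"] by (simp only: coeff_pcompose_linear)
    ultimately have pw: "c ^ (n - \<nu> j) = c' ^ (n - \<nu> j)" using a[OF j(1)] by simp
    have "c ^ (n - \<nu> j) * c ^ \<nu> j = c' ^ (n - \<nu> j) * c' ^ \<nu> j"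
      using \<nu>[OF j(1)] c by (simp flip: power_add)
    then have "c ^ \<nu> j = c' ^ \<nu> j" using pw \<open>c' \<noteq> 0\<close> by simp
    then show ?thesis using j \<open>c' \<noteq> 0\<close> by (simp add: power_divide)
  qed
  then have "c / c' = 1"
    by (rule root_of_unity_eq_1[OF \<open>0 < n\<close> _ _ gcd]) auto
  then show "c = c'" using \<open>c' \<noteq> 0\<close> by simp
qed

lemma param_poly_principal_root:
  assumes "0 < n" "z \<noteq> 0" "\<And>j. j \<in> {1..k} \<Longrightarrow> \<nu> j \<le> n"
  shows "(z powr (1 / of_nat n)) ^ n = z"
    "poly (param_poly m n k \<nu> a) (z powr (1 / of_nat n)) =
      m * z + (\<Sum>j=1..k. a j * z powr (1 - of_nat (\<nu> j) / of_nat n))"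
proof -
  show *: "(z powr (1 / of_nat n)) ^ n = z"
    using assms by (simp add: powr_power)
  have "(z powr (1 / of_nat n)) ^ (n - \<nu> j) = z powr (1 - of_nat (\<nu> j) / of_nat n)" if "j \<in> {1..k}" for j
    using assms(1,2) assms(3)[OF that] by (simp add: powr_power of_nat_diff diff_divide_distrib)
  then show "poly (param_poly m n k \<nu> a) (z powr (1 / of_nat n)) =
      m * z + (\<Sum>j=1..k. a j * z powr (1 - of_nat (\<nu> j) / of_nat n))"
    by (simp add: poly_param_poly *)
qed

text \<open>The pullback of h to the parameter line is a polynomial with arbitrarily large zeros,
  hence zero. So containing part of a branch near infinity forces containing the whole
  curve.\<close>

lemma param_in_zero_set_if_unbounded:
  fixes h :: "complex poly poly"
  assumes "\<And>b. \<exists>t. b \<le> norm t \<and> (t ^ n, poly q t) \<in> zero_set h"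
  shows "(t ^ n, poly q t) \<in> zero_set h"
proof -
  obtain G where G: "\<And>t u. poly (poly G [:u:]) t = poly (poly h [:poly q t + u:]) (t ^ n)"
    using substitute_param by metis
  have "poly G [:0:] = 0"
  proof (rule ccontr)
    assume "poly G [:0:] \<noteq> 0"
    from eventually_poly_nonzero[OF this] obtain b where "\<And>t. b \<le> norm t \<Longrightarrow> poly (poly G [:0:]) t \<noteq> 0"
      unfolding eventually_at_infinity by blast
    then show False using assms[of b] unfolding G zero_set_def by auto
  qed
  then show ?thesis using G[of 0 t] by (simp add: zero_set_def)
qed

theorem theorem3p11:
  fixes f :: "complex poly poly" and m :: complex
    and N :: nat and \<phi> :: "complex fps" and M :: real and B :: "(complex \<times> complex) set"
    and n k :: nat and \<nu> :: "nat \<Rightarrow> nat" and a :: "nat \<Rightarrow> complex"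
    and r\<^sub>t :: "complex \<Rightarrow> complex" and Q\<^sub>t :: "complex \<Rightarrow> complex \<times> complex" and M\<^sub>t :: real
  assumes "irreducible f"
    and "\<forall>i j. coeff (coeff f j) i \<in> \<real>"
    and "\<not> infinity_point f 0 1"
    and "branch_series f m N \<phi> M"
    and "B = branch N \<phi> M"
    and "\<forall>j\<in>{1..k}. a j \<noteq> 0"
    and "0 < n"
    and "\<forall>j\<in>{1..k}. 0 < \<nu> j \<and> \<nu> j \<le> n"
    and "strict_mono_on {1..k} \<nu>"
    and "Gcd (insert n (\<nu> ` {1..k})) = 1"
    and "{(q, c) \<in> branch_terms N \<phi>. 0 \<le> q} =
           (\<lambda>j. (1 - of_nat (\<nu> j) / of_nat n, a j)) ` {1..k}"
    and "\<forall>z. r\<^sub>t z = m * z + (\<Sum>j=1..k. a j * z powr (1 - of_nat (\<nu> j) / of_nat n))"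
    and "0 < M\<^sub>t"
    and "\<forall>t. Q\<^sub>t t = (t ^ n, m * t ^ n + (\<Sum>j=1..k. a j * t ^ (n - \<nu> j)))"
  shows "(\<exists>h. irreducible h \<and> {(z, r\<^sub>t z) | z. M\<^sub>t < norm z} \<subseteq> zero_set h) \<and>
    (\<forall>h. irreducible h \<and> {(z, r\<^sub>t z) | z. M\<^sub>t < norm z} \<subseteq> zero_set h \<longrightarrow>
       zero_set h = range Q\<^sub>t \<and> asymptote h f B)"
proof -
  define q where "q = param_poly m n k \<nu> a"
  have inj: "inj_on \<nu> {1..k}" using assms(9) by (rule strict_mono_on_imp_inj_on)
  interpret polynomial_parametrization n q
    unfolding q_def using assms(6,8)
    by (intro polynomial_parametrization_param_poly[OF _ assms(7) _ inj assms(10)]) blast+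
  have Q: "Q\<^sub>t = (\<lambda>t. (t ^ n, poly q t))"
    using assms(14) by (auto simp: q_def poly_param_poly)
  have root: "(z powr (1 / of_nat n)) ^ n = z" "poly q (z powr (1 / of_nat n)) = r\<^sub>t z" if "z \<noteq> 0" for z
    using param_poly_principal_root(1)[OF n_pos that, of k \<nu>]
      param_poly_principal_root(2)[OF n_pos that, of k \<nu> m a] assms(8,12) by (auto simp: q_def)
  have N: "0 < N" "fps_nth \<phi> 0 = m" using assms(4) by (auto simp: branch_series_def)

  obtain H where H: "irreducible H" "zero_set H = range (\<lambda>t. (t ^ n, poly q t))"
    using irreducible_equation_exists by blast
  have "(z, r\<^sub>t z) \<in> zero_set H" if "M\<^sub>t < norm z" for z
  proof -
    have "z \<noteq> 0" using that assms(13) by auto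
    from root[OF this] show ?thesis
      unfolding H(2) by (intro image_eqI[of _ _ "z powr (1 / of_nat n)"]) auto
  qed
  then have "\<exists>h. irreducible h \<and> {(z, r\<^sub>t z) | z. M\<^sub>t < norm z} \<subseteq> zero_set h"
    using H(1) by blast
  moreover have "zero_set h = range Q\<^sub>t \<and> asymptote h f B"
    if h: "irreducible h" and sub: "{(z, r\<^sub>t z) | z. M\<^sub>t < norm z} \<subseteq> zero_set h" for h
  proof -
    have unbounded: "\<exists>t. b \<le> norm t \<and> (t ^ n, poly q t) \<in> zero_set h" for b
    proof -
      define x where "x = \<bar>b\<bar> + M\<^sub>t + 1"
      have x: "1 \<le> x" "b \<le> x" "M\<^sub>t < x" using assms(13) by (auto simp: x_def)
      \<comment> \<open>An n-th power of a large positive real, so that the principal n-th root has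
        norm exactly x.\<close>
      define z :: complex where "z = of_real (x ^ n)"
      have nz: "norm z = x ^ n" using x(1) by (simp add: z_def norm_power del: of_real_power)
      have "x \<le> x ^ n" using x(1) n_pos by (simp add: self_le_power)
      then have "M\<^sub>t < norm z" using x(3) nz by simp
      then have "z \<noteq> 0" using assms(13) by auto
      define t where "t = z powr (1 / of_nat n)"
      have "norm t ^ n = x ^ n"
        using root(1)[OF \<open>z \<noteq> 0\<close>] nz by (simp flip: norm_power add: t_def)
      then have "norm t = x" using x(1) n_pos power_eq_imp_eq_base[of "norm t" n x] by simp
      moreover have "(t ^ n, poly q t) = (z, r\<^sub>t z)" using root[OF \<open>z \<noteq> 0\<close>] by (simp add: t_def)
      ultimately show ?thesis using sub x(2) \<open>M\<^sub>t < norm z\<close> by (intro exI[of _ t]) auto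
    qed
    note param = param_in_zero_set_if_unbounded[OF unbounded]
    \<comment> \<open>The leaf c = 1 uses the same principal values as \<open>r\<^sub>t\<close>, so
      the point of h with the same first coordinate bounds the distance by the terms of negative
      exponent.\<close>
    have "((\<lambda>z. infdist (z, leaf_fun N \<phi> 1 z) (zero_set h)) \<longlongrightarrow> 0) at_infinity"
    proof (rule Lim_null_comparison)
      show "((\<lambda>z. norm (leaf_fun N \<phi> 1 z - z * (\<Sum>i\<le>N. fps_nth \<phi> i * (z powr (- 1 / of_nat N)) ^ i))) \<longlongrightarrow> 0) at_infinity"
        using leaf_fun_tendsto[OF assms(4)] by (rule tendsto_norm_zero)
      have "\<forall>\<^sub>F z::complex in at_infinity. M\<^sub>t + 1 \<le> norm z"
        unfolding eventually_at_infinity by blast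
      then show "\<forall>\<^sub>F z in at_infinity. norm (infdist (z, leaf_fun N \<phi> 1 z) (zero_set h)) \<le>
          norm (leaf_fun N \<phi> 1 z - z * (\<Sum>i\<le>N. fps_nth \<phi> i * (z powr (- 1 / of_nat N)) ^ i))"
      proof eventually_elim
        case (elim z)
        then have "z \<noteq> 0" using assms(13) by auto
        have eq: "z * (\<Sum>i\<le>N. fps_nth \<phi> i * (z powr (- 1 / of_nat N)) ^ i) = r\<^sub>t z"
          using leaf_polynomial_part[OF N(1) n_pos \<open>z \<noteq> 0\<close> inj assms(11)] N(2) assms(12) by simp
        have "(z, r\<^sub>t z) \<in> zero_set h" using sub elim by auto
        then have "infdist (z, leaf_fun N \<phi> 1 z) (zero_set h) \<le> dist (z, leaf_fun N \<phi> 1 z) (z, r\<^sub>t z)"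
          by (rule infdist_le)
        also have "\<dots> = norm (leaf_fun N \<phi> 1 z - r\<^sub>t z)" by (simp add: dist_Pair_Pair dist_norm)
        finally show ?case unfolding eq by (simp add: infdist_nonneg)
      qed
    qed
    then have "approaches h f B"
      unfolding approaches_def using assms(4,5) by (metis power_one)
    then show ?thesis
      unfolding asymptote_def Q
      using perfect_curve_if_param[OF h param] irreducible_equation(1)[OF h param] by blast
  qed
  ultimately show ?thesis by blast
qed

end
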